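(* Let $k=1$ on the reference equilateral triangle, with the orthonormal Dubiner basis $\phi_1,\phi_2,\phi_3$. The matrices $\tilde{\mathbf Q}$ satisfying the extended-range conditions (E1)–(E3) of the context with $\tilde{\mathbf M}+\tilde{\mathbf Q}$ positive definite are exactly $$\tilde{\mathbf Q}=\begin{bmatrix}0&0&0\\0&q_0&0\\0&0&q_0\end{bmatrix},\qquad q_0>-1 .$$ The spectral difference (SD) correction with a single interior flux point at the element centroid (with normals in $x$ and $y$) is recovered when $q_0=1/3$; that is, for this $\tilde{\mathbf Q}$, $$\tilde{\mathbf Q}\tilde{\mathbf C}_{\mathrm{SD}}+\tilde{\mathbf M}(\tilde{\mathbf C}_{\mathrm{SD}}-\tilde{\mathbf C}_{\mathrm{DG}})=0 .$$
   Context: Reference triangle $\hat K$: vertices $(-1,-1/\sqrt3)$, $(1,-1/\sqrt3)$, $(0,2/\sqrt3)$, centroid at the origin. Dubiner basis of polynomials of total degree $\le k$: $\phi_i(x,y)=\frac{2}{3^{1/4}}(1-b)^v\psi_v^{(0,0)}(a)\psi_w^{(2v+1,0)}(b)$, $a=\frac{3x}{2-\sqrt3y}$, $b=\frac{2\sqrt3y-1}{3}$, $v,w\ge0$, $v+w\le k$, $i=w+1+v(2k+3-v)/2$, with $\psi_n^{(\alpha,\beta)}$ the Jacobi polynomial normalised to unit norm in $L^2([-1,1],(1-s)^\alpha(1+s)^\beta\mathrm ds)$. It is $L^2(\hat K)$-orthonormal, so the modal mass matrix $\tilde{\mathbf M}$ is the identity. $\tilde{\mathbf D}_x,\tilde{\mathbf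 D}_y$ are the matrices of $\partial_x,\partial_y$ in this basis. Extended-range conditions: (E1) $\tilde{\mathbf Q}=\tilde{\mathbf Q}^T$; (E2) $\tilde{\mathbf Q}\tilde{\mathbf D}_x+\tilde{\mathbf D}_x^T\tilde{\mathbf Q}^T=0$ and $\tilde{\mathbf Q}\tilde{\mathbf D}_y+\tilde{\mathbf D}_y^T\tilde{\mathbf Q}^T=0$; (E3) $\tilde{\mathbf Q}$ commutes with the matrices (in the basis $\phi_i$) of $f\mapsto f\circ R$, $R$ the rotation by $2\pi/3$ about the origin, and of $f(x,y)\mapsto f(-x,y)$. Correction matrices. Place $k+1$ distinct flux points on each edge, with outward unit normal. For flux point $j$ on edge $e$ let $\lambda_j$ be the polynomial of degree $k$ on $e$ equal to 1 at $j$ and 0 at the other flux points of $e$. The DG correction matrix is $\tilde{\mathbf C}_{\mathrm{DG}}=\tilde{\mathbf M}^{-1}\tilde{\mathbf L}_\partial^T\mathbf W_\partial$, with $(\tilde{\mathbf L}_\partial^T\mathbf W_\partial)_{mj}=\int_e\phi_m\lambda_j\,\mathrm ds$. The Raviart–Thomas space is $\mathbb{RT}_k=\mathbb Q_k^2+(x,y)^T(\mathbb Q_k\setminus\mathbb Q_{k-1}$-part$)$, i.e. the span of $\mathbb Q_k^2$ and of $(x\phi,y\phi)^T$ for the basis polynomials $\phi$ of degree exactly $k$, where $\mathbb Q_k$ is the space of polynomials of total degree $\le k$. Its SD degrees of freedom are the outward normal components at the boundary flux points and the $x$- and $y$-components at the interior flux points. The SD correction for boundary flux point $j$ is the element $\mathbf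 h_j\in\mathbb{RT}_k$ with normal component 1 at $j$ and all other degrees of freedom zero; column $j$ of $\tilde{\mathbf C}_{\mathrm{SD}}$ contains the coefficients of $\nabla\cdot\mathbf h_j$ in the basis $\phi_i$. *)

theory Defs
  imports
    "HOL-Analysis.Analysis"
    "HOL-Computational_Algebra.Polynomial"
    "Jordan_Normal_Form.Matrix"
    "Jordan_Normal_Form.Gauss_Jordan_Elimination"
begin

text \<open>
  Matrices have the type \<open>real mat\<close> of Jordan_Normal_Form, whose entries are numbered from 0:
  row or column \<open>m\<close> belongs to the basis polynomial \<open>dubiner k (m + 1)\<close>.
\<close>


section \<open>Reference triangle\<close>

text \<open>Counterclockwise; edge \<open>e\<close> runs from \<open>vertex e\<close> to \<open>vertex (Suc e)\<close>, indices modulo 3.\<close>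

definition vertex :: "nat \<Rightarrow> real \<times> real" where
  "vertex e = [(- 1, - 1 / sqrt 3), (1, - 1 / sqrt 3), (0, 2 / sqrt 3)] ! (e mod 3)"

definition ref_triangle :: "(real \<times> real) set" where
  "ref_triangle = convex hull {vertex 0, vertex 1, vertex 2}"

definition centroid :: "real \<times> real" where
  "centroid = (1 / 3) *\<^sub>R (vertex 0 + vertex 1 + vertex 2)"

definition edge_point :: "nat \<Rightarrow> real \<Rightarrow> real \<times> real" where
  "edge_point e t = (1 - t) *\<^sub>R vertex e + t *\<^sub>R vertex (Suc e)"

definition edge_length :: "nat \<Rightarrow> real" where
  "edge_length e = dist (vertex e) (vertex (Suc e))"

text \<open>The unit tangent turned clockwise by a right angle; outward as the vertices are
  counterclockwise.\<close>

definition outward_normal :: "nat \<Rightarrow> real \<times> real" where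
  "outward_normal e =
     (let d = vertex (Suc e) - vertex e in (1 / edge_length e) *\<^sub>R (snd d, - fst d))"


section \<open>Dubiner basis\<close>

text \<open>The Jacobi polynomial \<open>P\<^sub>n\<close> with the usual sign convention (positive leading coefficient). Only
  parameters in the natural numbers are needed.\<close>

definition jacobi :: "nat \<Rightarrow> nat \<Rightarrow> nat \<Rightarrow> real \<Rightarrow> real" where
  "jacobi \<alpha> \<beta> n s =
     (\<Sum>m\<le>n. real ((n + \<alpha>) choose (n - m)) * real ((n + \<beta>) choose m)
               * ((s - 1) / 2) ^ m * ((s + 1) / 2) ^ (n - m))"

definition normalized_jacobi :: "nat \<Rightarrow> nat \<Rightarrow> nat \<Rightarrow> real \<Rightarrow> real" where
  "normalized_jacobi \<alpha> \<beta> n s =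
     jacobi \<alpha> \<beta> n s / sqrt (integral {-1..1} (\<lambda>r. (jacobi \<alpha> \<beta> n r)\<^sup>2 * (1 - r) ^ \<alpha> * (1 + r) ^ \<beta>))"

definition poly_space :: "nat \<Rightarrow> (real \<times> real \<Rightarrow> real) set" where
  "poly_space k =
     {f. \<exists>c. \<forall>x y. f (x, y) = (\<Sum>(i, j)\<in>{(i, j). i + j \<le> k}. c i j * x ^ i * y ^ j)}"

definition dubiner_formula :: "nat \<Rightarrow> nat \<Rightarrow> real \<times> real \<Rightarrow> real" where
  "dubiner_formula v w = (\<lambda>(x, y).
     let a = 3 * x / (2 - sqrt 3 * y); b = (2 * sqrt 3 * y - 1) / 3
     in 2 / 3 powr (1 / 4) * (1 - b) ^ v * normalized_jacobi 0 0 v a * normalized_jacobi (2 * v + 1) 0 w b)"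

definition dubiner_index :: "nat \<Rightarrow> nat \<Rightarrow> nat \<Rightarrow> nat" where
  "dubiner_index k v w = w + 1 + v * (2 * k + 3 - v) div 2"

definition num_modes :: "nat \<Rightarrow> nat" where
  "num_modes k = (k + 1) * (k + 2) div 2"

text \<open>The formula divides by zero on the line \<open>sqrt 3 * y = 2\<close> through the apex; the basis
  function is the polynomial that agrees with it off this line.\<close>

definition dubiner :: "nat \<Rightarrow> nat \<Rightarrow> real \<times> real \<Rightarrow> real" where
  "dubiner k i = (THE p. p \<in> poly_space k \<and>
     (\<exists>v w. v + w \<le> k \<and> i = dubiner_index k v w \<and>
        (\<forall>x y. sqrt 3 * y \<noteq> 2 \<longrightarrow> p (x, y) = dubiner_formula v w (x, y))))"

definition modal_coeffs :: "nat \<Rightarrow> (real \<times> real \<Rightarrow> real) \<Rightarrow> real vec" where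
  "modal_coeffs k f = (THE c. c \<in> carrier_vec (num_modes k) \<and>
     (\<forall>p. f p = (\<Sum>m<num_modes k. vec_index c m * dubiner k (m + 1) p)))"

definition operator_matrix ::
  "nat \<Rightarrow> ((real \<times> real \<Rightarrow> real) \<Rightarrow> (real \<times> real \<Rightarrow> real)) \<Rightarrow> real mat" where
  "operator_matrix k T =
     mat (num_modes k) (num_modes k) (\<lambda>(m, n). vec_index (modal_coeffs k (T (dubiner k (n + 1)))) m)"

definition mass_matrix :: "nat \<Rightarrow> real mat" where
  "mass_matrix k = mat (num_modes k) (num_modes k)
     (\<lambda>(m, n). integral ref_triangle (\<lambda>p. dubiner k (m + 1) p * dubiner k (n + 1) p))"

definition partial_x :: "(real \<times> real \<Rightarrow> real) \<Rightarrow> (real \<times> real \<Rightarrow> real)" where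
  "partial_x f = (\<lambda>(x, y). deriv (\<lambda>t. f (t, y)) x)"

definition partial_y :: "(real \<times> real \<Rightarrow> real) \<Rightarrow> (real \<times> real \<Rightarrow> real)" where
  "partial_y f = (\<lambda>(x, y). deriv (\<lambda>t. f (x, t)) y)"

definition rotation :: "real \<times> real \<Rightarrow> real \<times> real" where
  "rotation = (\<lambda>(x, y). (cos (2 * pi / 3) * x - sin (2 * pi / 3) * y,
                         sin (2 * pi / 3) * x + cos (2 * pi / 3) * y))"

definition reflection :: "real \<times> real \<Rightarrow> real \<times> real" where
  "reflection = (\<lambda>(x, y). (- x, y))"


section \<open>Extended-range conditions\<close>

definition extended_range :: "nat \<Rightarrow> real mat \<Rightarrow> bool" where
  "extended_range k Q \<longleftrightarrow>
     (let N = num_modes k;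
          Dx = operator_matrix k partial_x;
          Dy = operator_matrix k partial_y;
          R = operator_matrix k (\<lambda>f. f \<circ> rotation);
          S = operator_matrix k (\<lambda>f. f \<circ> reflection)
      in Q \<in> carrier_mat N N \<and>
         Q = transpose_mat Q \<and>
         Q * Dx + transpose_mat Dx * transpose_mat Q = 0\<^sub>m N N \<and>
         Q * Dy + transpose_mat Dy * transpose_mat Q = 0\<^sub>m N N \<and>
         Q * R = R * Q \<and>
         Q * S = S * Q)"

definition positive_definite :: "real mat \<Rightarrow> bool" where
  "positive_definite A \<longleftrightarrow> square_mat A \<and> transpose_mat A = A \<and>
     (\<forall>v \<in> carrier_vec (dim_row A). v \<noteq> 0\<^sub>v (dim_row A) \<longrightarrow> 0 < scalar_prod v (A *\<^sub>v v))"


section \<open>Flux points and correction matrices\<close>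

text \<open>The boundary flux points are numbered edge by edge, \<open>P j\<close> for \<open>j < 3 * (k + 1)\<close>. A vertex is
  allowed as a flux point, and then possibly for both of its edges, as two points with different
  normals.\<close>

definition flux_edge :: "nat \<Rightarrow> nat \<Rightarrow> nat" where
  "flux_edge k j = j div (k + 1)"

definition flux_points :: "nat \<Rightarrow> (nat \<Rightarrow> real \<times> real) \<Rightarrow> bool" where
  "flux_points k P \<longleftrightarrow>
     (\<forall>j < 3 * (k + 1). P j \<in> closed_segment (vertex (flux_edge k j)) (vertex (Suc (flux_edge k j)))) \<and>
     (\<forall>e < 3. inj_on P {j. j < 3 * (k + 1) \<and> flux_edge k j = e})"

text \<open>A polynomial in the parameter of \<open>edge_point\<close>.\<close>

definition flux_lagrange :: "nat \<Rightarrow> (nat \<Rightarrow> real \<times> real) \<Rightarrow> nat \<Rightarrow> real poly" where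
  "flux_lagrange k P j = (THE q. degree q \<le> k \<and>
     (\<forall>i < 3 * (k + 1). \<forall>t. flux_edge k i = flux_edge k j \<and> edge_point (flux_edge k j) t = P i \<longrightarrow>
        poly q t = (if i = j then 1 else 0)))"

definition dg_boundary_matrix :: "nat \<Rightarrow> (nat \<Rightarrow> real \<times> real) \<Rightarrow> real mat" where
  "dg_boundary_matrix k P = mat (num_modes k) (3 * (k + 1))
     (\<lambda>(m, j). integral {0..1} (\<lambda>t. dubiner k (m + 1) (edge_point (flux_edge k j) t)
                 * poly (flux_lagrange k P j) t * edge_length (flux_edge k j)))"

definition C_DG :: "nat \<Rightarrow> (nat \<Rightarrow> real \<times> real) \<Rightarrow> real mat" where
  "C_DG k P = the (mat_inverse (mass_matrix k)) * dg_boundary_matrix k P"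

text \<open>The basis polynomials of degree exactly \<open>k\<close> are those with \<open>v + w = k\<close>.\<close>

definition raviart_thomas :: "nat \<Rightarrow> (real \<times> real \<Rightarrow> real \<times> real) set" where
  "raviart_thomas k = {h. \<exists>p\<in>poly_space k. \<exists>q\<in>poly_space k. \<exists>c. \<forall>z.
     h z = (p z, q z) + (\<Sum>v\<le>k. c v * dubiner k (dubiner_index k v (k - v)) z) *\<^sub>R z}"

definition divergence :: "(real \<times> real \<Rightarrow> real \<times> real) \<Rightarrow> (real \<times> real \<Rightarrow> real)" where
  "divergence h = (\<lambda>z. partial_x (\<lambda>u. fst (h u)) z + partial_y (\<lambda>u. snd (h u)) z)"

text \<open>\<open>I\<close> is the set of interior flux points.\<close>

definition sd_correction ::
  "nat \<Rightarrow> (nat \<Rightarrow> real \<times> real) \<Rightarrow> (real \<times> real) set \<Rightarrow> nat \<Rightarrow> (real \<times> real \<Rightarrow> real \<times> real)" where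
  "sd_correction k P I j = (THE h. h \<in> raviart_thomas k \<and>
     (\<forall>i < 3 * (k + 1). inner (h (P i)) (outward_normal (flux_edge k i)) = (if i = j then 1 else 0)) \<and>
     (\<forall>z\<in>I. fst (h z) = 0 \<and> snd (h z) = 0))"

definition C_SD :: "nat \<Rightarrow> (nat \<Rightarrow> real \<times> real) \<Rightarrow> (real \<times> real) set \<Rightarrow> real mat" where
  "C_SD k P I = mat (num_modes k) (3 * (k + 1))
     (\<lambda>(m, j). vec_index (modal_coeffs k (divergence (sd_correction k P I j))) m)"

end

theory Submission
  imports Defs
begin

text \<open>
  For degree 1 the Dubiner basis consists of \<open>1 / g\<close>, \<open>c * y\<close> and \<open>c * x\<close>, where \<open>g\<close> is the fourth root
  of 3 and \<open>c = sqrt 2 * g\<close>. Antisymmetry of \<open>Q D\<close> kills the first row and column of \<open>Q\<close>, the reflection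
  makes the remaining block diagonal and the rotation makes it scalar.

  An element of the Raviart-Thomas space that vanishes at the centroid has the form
  \<open>h z = A z + (b \<bullet> z) z\<close>. Its normal component is affine along every edge, so the flux points force it
  to be the Lagrange polynomial on one edge and zero on the others; the six end values of the normal
  components are linear coordinates for such fields. Integration by parts against \<open>\<phi>\<close> then gives
  \<open>C_DG = C_SD\<close> in the constant mode. In a linear mode the extra term is the integral of
  \<open>h \<bullet> grad \<phi>\<close>, which is one third of that of \<open>\<phi> div h\<close> because \<open>div ((b \<bullet> z) z) = 3 (b \<bullet> z)\<close>; this is
  the origin of the factor \<open>1 + 1 / 3\<close>.
\<close>

section \<open>Dubiner basis of degree one\<close>

definition affine_fun :: "real \<Rightarrow> real \<Rightarrow> real \<Rightarrow> real \<times> real \<Rightarrow> real" where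
  "affine_fun a b c = (\<lambda>(x, y). a + b * x + c * y)"

lemma affine_fun_apply [simp]: "affine_fun a b c (x, y) = a + b * x + c * y"
  by (simp add: affine_fun_def)

lemma affine_fun_eq_iff: "affine_fun a b c = affine_fun a' b' c' \<longleftrightarrow> a = a' \<and> b = b' \<and> c = c'"
proof
  assume eq: "affine_fun a b c = affine_fun a' b' c'"
  show "a = a' \<and> b = b' \<and> c = c'"
    using fun_cong[OF eq, of "(0, 0)"] fun_cong[OF eq, of "(1, 0)"] fun_cong[OF eq, of "(0, 1)"]
    by simp
qed simp

lemma poly_space_1: "f \<in> poly_space 1 \<longleftrightarrow> (\<exists>a b c. f = affine_fun a b c)"
proof -
  have S: "{(i, j). i + j \<le> (1::nat)} = {(0, 0), (1, 0), (0, 1)}"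
    by auto
  have "f \<in> poly_space 1 \<longleftrightarrow> (\<exists>c :: nat \<Rightarrow> nat \<Rightarrow> real. \<forall>x y. f (x, y) = c 0 0 + c 1 0 * x + c 0 1 * y)"
    unfolding poly_space_def S by (simp add: algebra_simps del: One_nat_def)
  also have "\<dots> \<longleftrightarrow> (\<exists>a b c. f = affine_fun a b c)"
  proof
    assume "\<exists>c :: nat \<Rightarrow> nat \<Rightarrow> real. \<forall>x y. f (x, y) = c 0 0 + c 1 0 * x + c 0 1 * y"
    then show "\<exists>a b c. f = affine_fun a b c"
      by (auto simp: affine_fun_def fun_eq_iff)
  next
    assume "\<exists>a b c. f = affine_fun a b c"
    then obtain a b c where "f = affine_fun a b c" by blast
    then show "\<exists>c :: nat \<Rightarrow> nat \<Rightarrow> real. \<forall>x y. f (x, y) = c 0 0 + c 1 0 * x + c 0 1 * y"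
      \<comment> \<open>Only the three exponent pairs of \<open>S\<close> enter the sum; the values
        at other pairs are arbitrary.\<close>
      by (intro exI[of _ "\<lambda>i j::nat. if i = 1 then b else if j = 1 then c else a"]) simp
  qed
  finally show ?thesis .
qed

text \<open>The index determines the pair of degrees, and an affine function is fixed by three
  non-collinear points off the singular line, so the \<open>THE\<close> in \<open>dubiner\<close>
  has only one candidate.\<close>

lemma dubiner_1_eqI:
  assumes vw: "v + w \<le> 1"
    and eq: "\<And>x y. sqrt 3 * y \<noteq> 2 \<Longrightarrow> dubiner_formula v w (x, y) = affine_fun a b c (x, y)"
  shows "dubiner 1 (dubiner_index 1 v w) = affine_fun a b c"
  unfolding dubiner_def
proof (rule the_equality)
  show "affine_fun a b c \<in> poly_space 1 \<and> (\<exists>v' w'. v' + w' \<le> 1 \<and>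
      dubiner_index 1 v w = dubiner_index 1 v' w' \<and>
      (\<forall>x y. sqrt 3 * y \<noteq> 2 \<longrightarrow> affine_fun a b c (x, y) = dubiner_formula v' w' (x, y)))"
    using vw eq unfolding poly_space_1 by metis
next
  fix p
  assume p: "p \<in> poly_space 1 \<and> (\<exists>v' w'. v' + w' \<le> 1 \<and>
      dubiner_index 1 v w = dubiner_index 1 v' w' \<and>
      (\<forall>x y. sqrt 3 * y \<noteq> 2 \<longrightarrow> p (x, y) = dubiner_formula v' w' (x, y)))"
  then obtain v' w' where v': "v' + w' \<le> 1" "dubiner_index 1 v w = dubiner_index 1 v' w'"
    and p': "\<And>x y. sqrt 3 * y \<noteq> 2 \<Longrightarrow> p (x, y) = dubiner_formula v' w' (x, y)"
    by blast
  have cases: "v = 0 \<and> w = 0 \<or> v = 0 \<and> w = 1 \<or> v = 1 \<and> w = 0" if "v + w \<le> 1" for v w :: nat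
    using that by linarith
  have "v' = v \<and> w' = w"
    using cases[OF vw] cases[OF v'(1)] v'(2) by (auto simp: dubiner_index_def)
  with p' eq have pa: "p (x, y) = affine_fun a b c (x, y)" if "sqrt 3 * y \<noteq> 2" for x y
    using that by simp
  obtain a' b' c' where pd: "p = affine_fun a' b' c'"
    using p poly_space_1 by blast
  \<comment> \<open>This puts the sample points \<open>(0, 1)\<close> and \<open>(1, 1)\<close> off
    the singular line through the apex.\<close>
  have "sqrt 3 \<noteq> 2"
    using real_sqrt_eq_iff[of 3 4] by simp
  with pa[of 0 0] pa[of 0 1] pa[of 1 1] show "p = affine_fun a b c"
    unfolding pd by simp
qed

section \<open>Normalised Jacobi polynomials of degree at most one\<close>

text \<open>The constant polynomial has to be normalised for the weight exponents 0, 1 and 3, so the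
  exponent is kept general.\<close>

lemma normalized_jacobi_0:
  "normalized_jacobi \<alpha> 0 0 s = 1 / sqrt (2 ^ (\<alpha> + 1) / (\<alpha> + 1))"
proof -
  define F :: "real \<Rightarrow> real" where "F r = - ((1 - r) ^ Suc \<alpha>) / Suc \<alpha>" for r
  have "((\<lambda>r. (1 - r) ^ \<alpha>) has_integral F 1 - F (- 1)) {-1..1}"
    unfolding F_def
    by (rule fundamental_theorem_of_calculus)
      (auto intro!: derivative_eq_intros simp del: power_Suc of_nat_Suc
        simp flip: has_real_derivative_iff_has_vector_derivative)
  then have "integral {-1..1} (\<lambda>r::real. (1 - r) ^ \<alpha>) = 2 ^ (\<alpha> + 1) / (\<alpha> + 1)"
    by (simp add: integral_unique F_def)
  then show ?thesis
    by (simp add: normalized_jacobi_def jacobi_def)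
qed

lemma normalized_jacobi_0_0_1: "normalized_jacobi 0 0 1 s = s / sqrt (2 / 3)"
proof -
  have j: "jacobi 0 0 1 r = r" for r
    by (simp add: jacobi_def field_simps)
  have "((\<lambda>r::real. r\<^sup>2) has_integral 1 ^ 3 / 3 - (- 1) ^ 3 / 3) {-1..1}"
    by (rule fundamental_theorem_of_calculus)
      (auto intro!: derivative_eq_intros simp flip: has_real_derivative_iff_has_vector_derivative)
  then show ?thesis
    unfolding normalized_jacobi_def j by (simp add: integral_unique)
qed

text \<open>The right-hand side is the plain Jacobi polynomial: its weighted norm is already
  1.\<close>

lemma normalized_jacobi_1_0_1: "normalized_jacobi 1 0 1 s = (3 * s + 1) / 2"
proof -
  have j: "jacobi 1 0 1 r = (3 * r + 1) / 2" for r
    by (simp add: jacobi_def field_simps)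
  define F :: "real \<Rightarrow> real" where "F r = (r + 5 / 2 * r ^ 2 + r ^ 3 - 9 / 4 * r ^ 4) / 4" for r
  have "((\<lambda>r. ((3 * r + 1) / 2)\<^sup>2 * (1 - r)) has_integral F 1 - F (- 1)) {-1..1}"
    unfolding F_def
    by (rule fundamental_theorem_of_calculus)
      (auto intro!: derivative_eq_intros simp flip: has_real_derivative_iff_has_vector_derivative
        simp: power2_eq_square power3_eq_cube field_simps)
  then show ?thesis
    unfolding normalized_jacobi_def j by (simp add: integral_unique F_def)
qed

text \<open>The fourth root called \<open>g\<close> in the overview, not the square root of
  3.\<close>

definition root3 :: real where
  "root3 = 3 powr (1 / 4)"

lemma root3_pos: "root3 > 0"
  by (simp add: root3_def)

lemma root3_sq: "root3 * root3 = sqrt 3"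
  by (simp add: root3_def powr_half_sqrt flip: powr_add)

text \<open>Both linear modes come out of \<open>dubiner_formula\<close> with the factor on the
  left; the one on the right is the \<open>c\<close> of the overview.\<close>

lemma two_sqrt3_div_root3: "2 * sqrt 3 / (root3 * sqrt 2) = sqrt 2 * root3"
  using root3_pos root3_sq by (simp add: field_simps)

lemma dubiner_1_1: "dubiner 1 1 = affine_fun (1 / root3) 0 0"
proof -
  have "dubiner_formula 0 0 (x, y) = 1 / root3" for x y
    by (simp add: dubiner_formula_def normalized_jacobi_0 Let_def mult.assoc flip: root3_def)
  with dubiner_1_eqI[of 0 0 "1 / root3" 0 0] show ?thesis
    by (simp add: dubiner_index_def)
qed

lemma dubiner_1_2: "dubiner 1 2 = affine_fun 0 0 (sqrt 2 * root3)"
proof -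
  have "dubiner_formula 0 1 (x, y) = sqrt 2 * root3 * y" for x y
  proof -
    \<comment> \<open>The parameter is left as \<open>2 * 0 + 1\<close> to match the unfolded
      \<open>dubiner_formula\<close>.\<close>
    have j: "normalized_jacobi (2 * 0 + 1) 0 1 s = (3 * s + 1) / 2" for s
      using normalized_jacobi_1_0_1[of s] by simp
    have "dubiner_formula 0 1 (x, y) = 2 / root3 * (1 / sqrt 2) * (sqrt 3 * y)"
      unfolding dubiner_formula_def Let_def prod.case j
      by (simp add: normalized_jacobi_0 field_simps flip: root3_def)
    also have "\<dots> = sqrt 2 * root3 * y"
      unfolding two_sqrt3_div_root3[symmetric] by simp
    finally show ?thesis .
  qed
  with dubiner_1_eqI[of 0 1 0 0 "sqrt 2 * root3"] show ?thesis
    by (simp add: dubiner_index_def numeral_2_eq_2)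
qed

text \<open>The factor \<open>1 - b\<close> is two thirds of the denominator \<open>d\<close> of
  \<open>a\<close>, so the singularity cancels and a multiple of \<open>x\<close> is left.\<close>

lemma dubiner_1_3: "dubiner 1 3 = affine_fun 0 (sqrt 2 * root3) 0"
proof -
  have "dubiner_formula 1 0 (x, y) = sqrt 2 * root3 * x" if "sqrt 3 * y \<noteq> 2" for x y
  proof -
    define d where "d = 2 - sqrt 3 * y"
    have d: "d \<noteq> 0" "1 - (2 * sqrt 3 * y - 1) / 3 = 2 * d / 3"
      using that by (auto simp: d_def field_simps)
    have "dubiner_formula 1 0 (x, y)
        = 2 / root3 * (2 * d / 3) * (3 * x / d / sqrt (2 / 3)) * (1 / sqrt (2 ^ 4 / 4))"
      unfolding dubiner_formula_def Let_def prod.case normalized_jacobi_0_0_1 d(2)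
      by (simp add: normalized_jacobi_0 d_def flip: root3_def)
    also have "\<dots> = 2 * sqrt 3 / (root3 * sqrt 2) * x"
      using d(1) root3_pos by (simp add: field_simps real_sqrt_divide)
    finally show ?thesis
      unfolding two_sqrt3_div_root3 .
  qed
  with dubiner_1_eqI[of 1 0 0 "sqrt 2 * root3" 0] show ?thesis
    by (simp add: dubiner_index_def numeral_3_eq_3)
qed

section \<open>Coordinates in the modal basis\<close>

lemma num_modes_1: "num_modes 1 = 3"
  by (simp add: num_modes_def)

lemma less_3_cases: "i < (3::nat) \<longleftrightarrow> i = 0 \<or> i = 1 \<or> i = 2"
  by auto

text \<open>The indices keep the form \<open>m + 1\<close> of the matrix definitions, so that these
  equations rewrite directly after a case split on \<open>m\<close>.\<close>

lemma dubiner_1: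
  "dubiner 1 (0 + 1) = affine_fun (1 / root3) 0 0"
  "dubiner 1 (1 + 1) = affine_fun 0 0 (sqrt 2 * root3)"
  "dubiner 1 (2 + 1) = affine_fun 0 (sqrt 2 * root3) 0"
  using dubiner_1_1 dubiner_1_2 dubiner_1_3 by (simp_all only: nat_1_add_1 numeral_plus_one arith_simps add_0)

text \<open>A combination of the three modes is an affine function with rescaled coefficients
  (\<open>S\<close>), so comparing coefficients gives existence and uniqueness. The \<open>y\<close>
  coefficient \<open>c\<close> comes before the \<open>x\<close> coefficient \<open>b\<close>
  because the second mode is the one in \<open>y\<close>.\<close>

lemma modal_coeffs_1:
  "modal_coeffs 1 (affine_fun a b c) =
     vec_of_list [root3 * a, c / (sqrt 2 * root3), b / (sqrt 2 * root3)]" (is "_ = ?v")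
proof -
  define w where "w = ?v"
  have idx: "vec_index w 0 = root3 * a" "vec_index w 1 = c / (sqrt 2 * root3)"
    "vec_index w 2 = b / (sqrt 2 * root3)" and dim: "dim_vec w = 3"
    unfolding w_def by (simp_all add: vec_of_list_index del: vec_of_list_Cons)
  have w: "a = vec_index w 0 / root3" "b = vec_index w 2 * (sqrt 2 * root3)"
    "c = vec_index w 1 * (sqrt 2 * root3)"
    unfolding idx using root3_pos by simp_all
  have three: "{..<3} = {0, 1, 2::nat}"
    by auto
  have S: "(\<Sum>m<3. vec_index v m * dubiner 1 (m + 1) p) =
      affine_fun (vec_index v 0 / root3) (vec_index v 2 * (sqrt 2 * root3))
        (vec_index v 1 * (sqrt 2 * root3)) p" for v p
  proof (cases p)
    case (Pair x y)
    have "(\<Sum>m<3. vec_index v m * dubiner 1 (m + 1) p) = vec_index v 0 * dubiner 1 (0 + 1) p +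
      (vec_index v 1 * dubiner 1 (1 + 1) p + vec_index v 2 * dubiner 1 (2 + 1) p)"
      unfolding three by (subst sum.insert; simp)+
    then show ?thesis
      unfolding dubiner_1 Pair by simp
  qed
  show ?thesis
    unfolding modal_coeffs_def num_modes_1 w_def[symmetric]
  proof (rule the_equality)
    show "w \<in> carrier_vec 3 \<and> (\<forall>p. affine_fun a b c p = (\<Sum>m<3. vec_index w m * dubiner 1 (m + 1) p))"
      unfolding S w using dim by (auto intro: carrier_vecI)
  next
    fix v
    assume v: "v \<in> carrier_vec 3 \<and>
      (\<forall>p. affine_fun a b c p = (\<Sum>m<3. vec_index v m * dubiner 1 (m + 1) p))"
    then have "affine_fun a b c = affine_fun (vec_index v 0 / root3)
        (vec_index v 2 * (sqrt 2 * root3)) (vec_index v 1 * (sqrt 2 * root3))"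
      unfolding S by auto
    then have "vec_index v 0 = vec_index w 0 \<and> vec_index v 1 = vec_index w 1
        \<and> vec_index v 2 = vec_index w 2"
      using root3_pos unfolding w affine_fun_eq_iff by simp
    then show "v = w"
      using v dim by (intro eq_vecI) (auto simp: less_3_cases)
  qed
qed

text \<open>Each assumption expands the image of one mode, hence one column. The scale factors of
  the modes are split off so that \<open>a\<close>, \<open>b\<close>, \<open>c\<close> are the
  entries themselves; \<open>b\<close> belongs to the \<open>y\<close> mode and \<open>c\<close> to
  the \<open>x\<close> mode.\<close>

lemma operator_matrix_1:
  assumes "T (affine_fun (1 / root3) 0 0) = affine_fun (a0 / root3) (sqrt 2 * root3 * c0) (sqrt 2 * root3 * b0)"
    and "T (affine_fun 0 0 (sqrt 2 * root3)) = affine_fun (a1 / root3) (sqrt 2 * root3 * c1) (sqrt 2 * root3 * b1)"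
    and "T (affine_fun 0 (sqrt 2 * root3) 0) = affine_fun (a2 / root3) (sqrt 2 * root3 * c2) (sqrt 2 * root3 * b2)"
  shows "operator_matrix 1 T = mat_of_rows_list 3 [[a0, a1, a2], [b0, b1, b2], [c0, c1, c2]]"
proof -
  have "vec_index (modal_coeffs 1 (T (dubiner 1 (n + 1)))) m =
      [[a0, a1, a2], [b0, b1, b2], [c0, c1, c2]] ! m ! n" if "m < 3" "n < 3" for m n
    using that root3_pos unfolding less_3_cases
    by (elim disjE; simp only: dubiner_1 assms modal_coeffs_1)
      (simp_all add: vec_of_list_index del: vec_of_list_Cons)
  then show ?thesis
    unfolding operator_matrix_def num_modes_1
    by (intro eq_matI) (auto simp: mat_of_rows_list_def)
qed

section \<open>Mass matrix\<close>

text \<open>\<open>vertex 3\<close> is listed because edge 2 ends there.\<close>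

lemma vertex_simps:
  "vertex 0 = (- 1, - (sqrt 3 / 3))" "vertex 1 = (1, - (sqrt 3 / 3))" "vertex 2 = (0, 2 * sqrt 3 / 3)"
  "vertex 3 = (- 1, - (sqrt 3 / 3))"
  by (simp_all add: vertex_def field_simps)

text \<open>Describes the triangle by horizontal slices symmetric about 0, the form needed for
  iterated integration.\<close>

lemma ref_triangle_eq:
  "ref_triangle = {(x, y). - 1 / sqrt 3 \<le> y \<and> \<bar>x\<bar> \<le> (2 - sqrt 3 * y) / 3}"
proof (rule Set.set_eqI)
  fix z :: "real \<times> real"
  obtain x y where z: "z = (x, y)" by (cases z)
  define s :: real where "s = sqrt 3"
  have s: "s > 0" "s * s = 3"
    by (simp_all add: s_def)
  have B: "- 1 / s \<le> y \<longleftrightarrow> - 1 \<le> s * y"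
    using s(1) by (simp add: field_simps)
  have "z = u *\<^sub>R vertex 0 + v *\<^sub>R vertex 1 + w *\<^sub>R vertex 2 \<longleftrightarrow>
      x = v - u \<and> y = (2 * w - u - v) * s / 3" for u v w
    unfolding z vertex_simps s_def[symmetric] by (auto simp: field_simps)
  then have "z \<in> ref_triangle \<longleftrightarrow> (\<exists>u v w. 0 \<le> u \<and> 0 \<le> v \<and> 0 \<le> w \<and> u + v + w = 1 \<and>
      x = v - u \<and> y = (2 * w - u - v) * s / 3)"
    unfolding ref_triangle_def convex_hull_3 by auto
  also have "\<dots> \<longleftrightarrow> - 1 / s \<le> y \<and> \<bar>x\<bar> \<le> (2 - s * y) / 3"
  proof
    assume "\<exists>u v w. 0 \<le> u \<and> 0 \<le> v \<and> 0 \<le> w \<and> u + v + w = 1 \<and>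
      x = v - u \<and> y = (2 * w - u - v) * s / 3"
    then obtain u v w where uvw: "0 \<le> u" "0 \<le> v" "0 \<le> w" "u + v + w = 1"
      "x = v - u" "y = (2 * w - u - v) * s / 3" by blast
    have "s * y = (2 * w - u - v) * (s * s) / 3"
      by (subst uvw(6)) (simp add: algebra_simps)
    then have "s * y = 2 * w - u - v"
      using s(2) by simp
    then have "(2 - s * y) / 3 = u + v" "- 1 \<le> s * y"
      using uvw(1-4) by simp_all
    then show "- 1 / s \<le> y \<and> \<bar>x\<bar> \<le> (2 - s * y) / 3"
      unfolding B using uvw(1,2,5) by (auto simp: abs_if)
  next
    assume A: "- 1 / s \<le> y \<and> \<bar>x\<bar> \<le> (2 - s * y) / 3"
    \<comment> \<open>Barycentric coordinates of \<open>(x, y)\<close>: \<open>w\<close> belongs to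
      the apex, while \<open>u\<close> and \<open>v\<close> have sum \<open>1 - w\<close> and
      difference \<open>v - u = x\<close>.\<close>
    define w where "w = (1 + s * y) / 3"
    define u where "u = (1 - w - x) / 2"
    define v where "v = (1 - w + x) / 2"
    have "(2 * w - u - v) * s / 3 = (s * s) * y / 3"
      by (simp add: u_def v_def w_def field_simps)
    then have "y = (2 * w - u - v) * s / 3"
      using s(2) by simp
    moreover have "0 \<le> u \<and> 0 \<le> v \<and> 0 \<le> w \<and> u + v + w = 1 \<and> x = v - u"
      using A unfolding B u_def v_def w_def by (auto simp: abs_le_iff field_simps)
    ultimately show "\<exists>u v w. 0 \<le> u \<and> 0 \<le> v \<and> 0 \<le> w \<and> u + v + w = 1 \<and>
      x = v - u \<and> y = (2 * w - u - v) * s / 3"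
      by blast
  qed
  finally show "z \<in> ref_triangle \<longleftrightarrow> z \<in> {(x, y). - 1 / sqrt 3 \<le> y \<and> \<bar>x\<bar> \<le> (2 - sqrt 3 * y) / 3}"
    by (simp add: z s_def)
qed

text \<open>The area is \<open>sqrt 3\<close>; the first moments and the mixed moment vanish by
  symmetry, and both second moments equal \<open>1 / (2 * sqrt 3)\<close>. Quadratics suffice for
  products of two affine functions. The proof is Fubini with the inner integral in
  \<open>x\<close>.\<close>

lemma integral_ref_triangle_quadratic:
  fixes a b c d e f :: real
  shows "integral ref_triangle (\<lambda>(x, y). a + b * x + c * y + d * x\<^sup>2 + e * x * y + f * y\<^sup>2) =
    sqrt 3 * a + (d + f) / (2 * sqrt 3)"
proof -
  define s :: real where "s = sqrt 3"
  have s: "s > 0" "s * s = 3" "1 / s = s / 3" "2 / s = 2 * s / 3"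
    by (simp_all add: s_def field_simps)
  have ss: "s * (s * t) = 3 * t" for t
    using s(2) by (simp flip: mult.assoc)
  \<comment> \<open>\<open>l y\<close> is half the width of the slice at height \<open>y\<close>,
    and \<open>q y\<close> below is the integral over that slice, where the odd powers of
    \<open>x\<close> cancel.\<close>
  define l where "l y = (2 - s * y) / 3" for y
  define p where "p x y = a + b * x + c * y + d * x\<^sup>2 + e * x * y + f * y\<^sup>2" for x y
  define q where "q y = 2 * (a + c * y + f * y\<^sup>2) * l y + 2 / 3 * d * (l y) ^ 3" for y
  \<comment> \<open>Compactness and continuity give the integrability that both Fubini and the
    return from the Lebesgue to the gauge integral require.\<close>
  have "compact ref_triangle"
    unfolding ref_triangle_def by (intro compact_convex_hull) (simp add: finite_imp_compact)
  moreover have "continuous_on ref_triangle (\<lambda>(x, y). p x y)"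
    unfolding p_def case_prod_unfold by (intro continuous_intros)
  ultimately have int: "set_integrable lborel ref_triangle (\<lambda>(x, y). p x y)"
    by (rule borel_integrable_compact[unfolded set_integrable_def[symmetric]])
  have inner: "(\<integral>x. indicator ref_triangle (x, y) * p x y \<partial>lborel)
      = q y * indicator {- (s / 3)..2 * s / 3} y" for y
  proof -
    have tri: "(x, y) \<in> ref_triangle \<longleftrightarrow> - (s / 3) \<le> y \<and> - l y \<le> x \<and> x \<le> l y" for x
    proof -
      have "(x, y) \<in> ref_triangle \<longleftrightarrow> - (1 / s) \<le> y \<and> \<bar>x\<bar> \<le> l y"
        unfolding ref_triangle_eq l_def s_def[symmetric] by simp
      then show ?thesis
        unfolding s(3) by auto
    qed
    have ly: "0 \<le> l y \<longleftrightarrow> y \<le> 2 * s / 3"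
      using s by (simp add: l_def flip: s(4)) (simp add: field_simps)
    show ?thesis
    proof (cases "y \<in> {- (s / 3)..2 * s / 3}")
      case True
      define F where "F x = (a + c * y + f * y\<^sup>2) * x + (b + e * y) * x\<^sup>2 / 2 + d * x ^ 3 / 3" for x
      have "(\<integral>x. p x y * indicator {- l y..l y} x \<partial>lborel) = F (l y) - F (- l y)"
      proof (rule integral_FTC_Icc_real)
        show "- l y \<le> l y" using True ly by simp
        show "(F has_real_derivative p x y) (at x)" for x
          unfolding F_def p_def
          by (auto intro!: derivative_eq_intros simp: algebra_simps power2_eq_square)
        show "isCont (\<lambda>x. p x y) x" for x
          unfolding p_def by (intro continuous_intros)
      qed
      also have "F (l y) - F (- l y) = q y"
        by (simp add: F_def q_def field_simps)
      also have "(\<lambda>x. p x y * indicator {- l y..l y} x) = (\<lambda>x. indicator ref_triangle (x, y) * p x y)"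
        using True by (auto simp: fun_eq_iff tri indicator_def)
      finally show ?thesis using True by simp
    next
      case False
      then have "(x, y) \<notin> ref_triangle" for x
        unfolding tri using ly by auto
      then show ?thesis using False by simp
    qed
  qed
  \<comment> \<open>An antiderivative of \<open>q\<close>, obtained by expanding \<open>q\<close> in
    powers of \<open>y\<close> with \<open>s * s = 3\<close>.\<close>
  define G where "G y = (4 / 3 * a + 16 / 81 * d) * y
      + (4 / 3 * c - 2 / 3 * s * a - 8 / 27 * s * d) * y\<^sup>2 / 2
      + (4 / 3 * f - 2 / 3 * s * c + 4 / 9 * d) * y ^ 3 / 3
      - (2 / 3 * s * f + 2 / 27 * s * d) * y ^ 4 / 4" for y
  have "set_lebesgue_integral lborel ref_triangle (\<lambda>(x, y). p x y)
      = (\<integral>z. (\<lambda>(x, y). indicator ref_triangle (x, y) * p x y) z \<partial>(lborel \<Otimes>\<^sub>M lborel))"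
    unfolding set_lebesgue_integral_def lborel_prod by (intro Bochner_Integration.integral_cong) auto
  also have "\<dots> = (\<integral>y. (\<integral>x. indicator ref_triangle (x, y) * p x y \<partial>lborel) \<partial>lborel)"
  proof (rule lborel_pair.integral_snd[symmetric])
    show "integrable (lborel \<Otimes>\<^sub>M lborel) (\<lambda>(x, y). indicator ref_triangle (x, y) * p x y)"
      using int unfolding set_integrable_def lborel_prod by (simp add: case_prod_unfold)
  qed
  also have "\<dots> = (\<integral>y. q y * indicator {- (s / 3)..2 * s / 3} y \<partial>lborel)"
    unfolding inner ..
  also have "\<dots> = G (2 * s / 3) - G (- (s / 3))"
  proof (rule integral_FTC_Icc_real)
    show "- (s / 3) \<le> 2 * s / 3" using s(1) by simp
    show "(G has_real_derivative q y) (at y)" for y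
    proof -
      have q: "q y = (4 / 3 * a + 16 / 81 * d) + (4 / 3 * c - 2 / 3 * s * a - 8 / 27 * s * d) * y
          + (4 / 3 * f - 2 / 3 * s * c + 4 / 9 * d) * y\<^sup>2 - (2 / 3 * s * f + 2 / 27 * s * d) * y ^ 3"
        by (simp add: q_def l_def power2_eq_square power3_eq_cube add_divide_distrib
          diff_divide_distrib algebra_simps s(2) ss)
      show ?thesis
        unfolding G_def q by (auto intro!: derivative_eq_intros)
    qed
    show "isCont q y" for y
      unfolding q_def l_def by (intro continuous_intros) simp_all
  qed
  also have "\<dots> = s * a + (d + f) * s / 6"
    unfolding G_def
    by (simp add: power2_eq_square power3_eq_cube power4_eq_xxxx algebra_simps s(2) ss)
      (simp add: field_simps)
  also have "\<dots> = sqrt 3 * a + (d + f) / (2 * sqrt 3)"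
    using s(1) unfolding s_def[symmetric] by (simp add: field_simps ss)
  finally have "set_lebesgue_integral lborel ref_triangle (\<lambda>(x, y). p x y) =
      sqrt 3 * a + (d + f) / (2 * sqrt 3)" .
  then show ?thesis
    using set_borel_integral_eq_integral(2)[OF int] by (simp add: p_def)
qed

text \<open>The squared scale factors \<open>1 / sqrt 3\<close> and \<open>2 * sqrt 3\<close> of the
  modes are the reciprocals of the area and of the second moments.\<close>

lemma mass_matrix_1: "mass_matrix 1 = 1\<^sub>m 3"
proof (rule eq_matI)
  fix m n
  assume mn: "m < dim_row (1\<^sub>m 3 :: real mat)" "n < dim_col (1\<^sub>m 3 :: real mat)"
  have "integral ref_triangle (\<lambda>p. affine_fun a b c p * affine_fun a' b' c' p)
      = sqrt 3 * a * a' + (b * b' + c * c') / (2 * sqrt 3)" for a b c a' b' c'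
  proof -
    have eq: "(\<lambda>p. affine_fun a b c p * affine_fun a' b' c' p) = (\<lambda>(x, y). a * a' + (a * b' + b * a') * x
        + (a * c' + c * a') * y + b * b' * x\<^sup>2 + (b * c' + c * b') * x * y + c * c' * y\<^sup>2)"
      by (auto simp: fun_eq_iff algebra_simps power2_eq_square)
    show ?thesis
      unfolding eq integral_ref_triangle_quadratic by (simp only: mult.assoc)
  qed
  note I = this
  have "sqrt 2 * (root3 * (sqrt 2 * root3)) = (sqrt 2 * sqrt 2) * (root3 * root3)"
    by (simp only: mult_ac)
  then have sq: "1 / root3 * (1 / root3) = 1 / sqrt 3"
    "sqrt 2 * (root3 * (sqrt 2 * root3)) = 2 * sqrt 3"
    by (simp_all flip: root3_sq)
  have "mass_matrix 1 $$ (m, n) = integral ref_triangle (\<lambda>p. dubiner 1 (m + 1) p * dubiner 1 (n + 1) p)"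
    using mn unfolding mass_matrix_def num_modes_1 by simp
  also have "\<dots> = (if m = n then 1 else 0)"
    using mn unfolding index_one_mat less_3_cases
    by (elim disjE; simp only: dubiner_1 I mult.assoc sq) simp_all
  finally show "mass_matrix 1 $$ (m, n) = 1\<^sub>m 3 $$ (m, n)"
    using mn by simp
qed (simp_all add: mass_matrix_def num_modes_1[simplified])

section \<open>Extended-range matrices\<close>

text \<open>An abbreviation rather than a definition, so the matrices in the theorem are literally
  of this form. The rules below turn matrix identities into equations between the nine
  entries.\<close>

abbreviation mat3 :: "real \<Rightarrow> real \<Rightarrow> real \<Rightarrow> real \<Rightarrow> real \<Rightarrow> real \<Rightarrow> real \<Rightarrow> real \<Rightarrow> real \<Rightarrow> real mat" where
  "mat3 a b c d e f g h i \<equiv> mat_of_rows_list 3 [[a, b, c], [d, e, f], [g, h, i]]"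

lemma mat3_carrier: "mat3 a b c d e f g h i \<in> carrier_mat 3 3"
  by (intro carrier_matI) (simp_all add: mat_of_rows_list_def)

lemma mat3_index:
  "mat3 a b c d e f g h i $$ (0, 0) = a" "mat3 a b c d e f g h i $$ (0, 1) = b"
  "mat3 a b c d e f g h i $$ (0, 2) = c" "mat3 a b c d e f g h i $$ (1, 0) = d"
  "mat3 a b c d e f g h i $$ (1, 1) = e" "mat3 a b c d e f g h i $$ (1, 2) = f"
  "mat3 a b c d e f g h i $$ (2, 0) = g" "mat3 a b c d e f g h i $$ (2, 1) = h"
  "mat3 a b c d e f g h i $$ (2, 2) = i"
  by (simp_all add: mat_of_rows_list_def)

lemma mat3_eqI:
  assumes "A \<in> carrier_mat 3 3" "A $$ (0, 0) = a" "A $$ (0, 1) = b" "A $$ (0, 2) = c"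
    "A $$ (1, 0) = d" "A $$ (1, 1) = e" "A $$ (1, 2) = f"
    "A $$ (2, 0) = g" "A $$ (2, 1) = h" "A $$ (2, 2) = i"
  shows "A = mat3 a b c d e f g h i"
proof (rule eq_matI)
  fix m n assume "m < dim_row (mat3 a b c d e f g h i)" "n < dim_col (mat3 a b c d e f g h i)"
  then have "m < 3" "n < 3"
    using mat3_carrier[of a b c d e f g h i] by auto
  then show "A $$ (m, n) = mat3 a b c d e f g h i $$ (m, n)"
    unfolding less_3_cases by (elim disjE; simp only: assms mat3_index)
qed (use assms(1) mat3_carrier[of a b c d e f g h i] in auto)

lemma mat3_eq_iff:
  "mat3 a b c d e f g h i = mat3 a' b' c' d' e' f' g' h' i' \<longleftrightarrow>
    a = a' \<and> b = b' \<and> c = c' \<and> d = d' \<and> e = e' \<and> f = f' \<and> g = g' \<and> h = h' \<and> i = i'"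
  by (metis mat3_index)

lemma mat3_mult:
  "mat3 a b c d e f g h i * mat3 a' b' c' d' e' f' g' h' i' =
    mat3 (a * a' + b * d' + c * g') (a * b' + b * e' + c * h') (a * c' + b * f' + c * i')
      (d * a' + e * d' + f * g') (d * b' + e * e' + f * h') (d * c' + e * f' + f * i')
      (g * a' + h * d' + i * g') (g * b' + h * e' + i * h') (g * c' + h * f' + i * i')"
proof -
  have three: "{0..<3} = {0, 1, 2::nat}" by auto
  have *: "(A * B) $$ (m, n) = A $$ (m, 0) * B $$ (0, n) + A $$ (m, 1) * B $$ (1, n) + A $$ (m, 2) * B $$ (2, n)"
    if "A \<in> carrier_mat 3 3" "B \<in> carrier_mat 3 3" "m < 3" "n < 3" for A B :: "real mat" and m n
    using that by (simp add: scalar_prod_def three)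
  show ?thesis
    by (rule mat3_eqI, rule mult_carrier_mat[OF mat3_carrier mat3_carrier]) (simp_all only: * mat3_carrier mult_carrier_mat mat3_index less_3_cases simp_thms)
qed

lemma mat3_add:
  "mat3 a b c d e f g h i + mat3 a' b' c' d' e' f' g' h' i' =
    mat3 (a + a') (b + b') (c + c') (d + d') (e + e') (f + f') (g + g') (h + h') (i + i')"
  by (rule mat3_eqI, rule add_carrier_mat[OF mat3_carrier]) (simp_all add: mat_of_rows_list_def)

lemma mat3_transpose: "transpose_mat (mat3 a b c d e f g h i) = mat3 a d g b e h c f i"
  by (rule mat3_eqI, rule transpose_carrier_mat[THEN iffD2, OF mat3_carrier])
    (simp_all add: mat_of_rows_list_def)

lemma mat3_zero: "0\<^sub>m 3 3 = mat3 0 0 0 0 0 0 0 0 0"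
  by (rule mat3_eqI) simp_all

lemma mat3_one: "1\<^sub>m 3 = mat3 1 0 0 0 1 0 0 0 1"
  by (rule mat3_eqI) simp_all

section \<open>Matrices of the derivatives and of the symmetries\<close>

lemma partial_x_affine_fun: "partial_x (affine_fun a b c) = affine_fun b 0 0"
  by (auto simp: partial_x_def fun_eq_iff intro!: DERIV_imp_deriv derivative_eq_intros)

lemma partial_y_affine_fun: "partial_y (affine_fun a b c) = affine_fun c 0 0"
  by (auto simp: partial_y_def fun_eq_iff intro!: DERIV_imp_deriv derivative_eq_intros)

lemma affine_fun_rotation:
  "affine_fun a b c \<circ> rotation = affine_fun a
    (b * cos (2 * pi / 3) + c * sin (2 * pi / 3)) (c * cos (2 * pi / 3) - b * sin (2 * pi / 3))"
  by (auto simp: rotation_def affine_fun_def fun_eq_iff algebra_simps)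

lemma affine_fun_reflection: "affine_fun a b c \<circ> reflection = affine_fun a (- b) c"
  by (auto simp: reflection_def affine_fun_def fun_eq_iff)

text \<open>The derivative of the \<open>x\<close> mode is the constant
  \<open>sqrt 2 * root3\<close>, which is \<open>sqrt 2 * root3 * root3\<close> times the first
  mode.\<close>

lemma operator_matrix_1_partial_x:
  "operator_matrix 1 partial_x = mat3 0 0 (sqrt 2 * sqrt 3) 0 0 0 0 0 0"
  by (rule operator_matrix_1)
    (use root3_pos in \<open>simp_all add: partial_x_affine_fun flip: root3_sq\<close>)

lemma operator_matrix_1_partial_y:
  "operator_matrix 1 partial_y = mat3 0 (sqrt 2 * sqrt 3) 0 0 0 0 0 0 0"
  by (rule operator_matrix_1)
    (use root3_pos in \<open>simp_all add: partial_y_affine_fun flip: root3_sq\<close>)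

lemma operator_matrix_1_rotation:
  "operator_matrix 1 (\<lambda>f. f \<circ> rotation) = mat3 1 0 0
    0 (cos (2 * pi / 3)) (- sin (2 * pi / 3)) 0 (sin (2 * pi / 3)) (cos (2 * pi / 3))"
  by (rule operator_matrix_1) (simp_all add: affine_fun_rotation)

lemma operator_matrix_1_reflection:
  "operator_matrix 1 (\<lambda>f. f \<circ> reflection) = mat3 1 0 0 0 1 0 0 0 (- 1)"
  by (rule operator_matrix_1) (simp_all add: affine_fun_reflection)

lemma extended_range_1_iff: "extended_range 1 Q \<longleftrightarrow> (\<exists>q. Q = mat3 0 0 0 0 q 0 0 0 q)"
proof
  assume er: "extended_range 1 Q"
  define a b c d e f g h i where defs: "a = Q $$ (0, 0)" "b = Q $$ (0, 1)" "c = Q $$ (0, 2)"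
    "d = Q $$ (1, 0)" "e = Q $$ (1, 1)" "f = Q $$ (1, 2)"
    "g = Q $$ (2, 0)" "h = Q $$ (2, 1)" "i = Q $$ (2, 2)"
  have Q: "Q = mat3 a b c d e f g h i"
    using er by (intro mat3_eqI) (simp_all add: extended_range_def num_modes_1[simplified] Let_def defs)
  have er':
    "Q = transpose_mat Q"
    "Q * operator_matrix 1 partial_x + transpose_mat (operator_matrix 1 partial_x) * transpose_mat Q = 0\<^sub>m 3 3"
    "Q * operator_matrix 1 partial_y + transpose_mat (operator_matrix 1 partial_y) * transpose_mat Q = 0\<^sub>m 3 3"
    "Q * operator_matrix 1 (\<lambda>f. f \<circ> rotation) = operator_matrix 1 (\<lambda>f. f \<circ> rotation) * Q"
    "Q * operator_matrix 1 (\<lambda>f. f \<circ> reflection) = operator_matrix 1 (\<lambda>f. f \<circ> reflection) * Q"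
    using er unfolding extended_range_def Let_def num_modes_1 by blast+
  note mat3 = mat3_transpose mat3_mult mat3_add mat3_zero mat3_eq_iff
  have sym: "d = b" "g = c" "h = f"
    using er'(1) unfolding Q mat3 by blast+
  \<comment> \<open>Multiplying by the matrix of \<open>partial_x\<close> moves the first column of
    \<open>Q\<close>, times a nonzero factor, into the last one. The entries \<open>(0, 2)\<close>
    and \<open>(1, 2)\<close> of the antisymmetry condition are then multiples of \<open>a\<close>
    and \<open>b\<close>.\<close>
  have "a = 0" "b = 0"
    using er'(2) unfolding Q sym operator_matrix_1_partial_x mat3 by simp_all
  moreover have "c = 0"
    using er'(3) unfolding Q sym operator_matrix_1_partial_y mat3 by simp
  moreover have f: "f = 0"
    using er'(5) unfolding Q sym operator_matrix_1_reflection mat3 by simp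
  \<comment> \<open>With \<open>f = 0\<close>, entry \<open>(1, 2)\<close> of the commutation
    relation reads \<open>e\<close> times the sine equals \<open>i\<close> times the sine, up to a
    common sign.\<close>
  moreover have "sin (2 * pi / 3) > 0"
    by (intro sin_gt_zero) simp_all
  then have "i = e"
    using arg_cong[OF er'(4), of "\<lambda>M. M $$ (1, 2)"]
    unfolding Q sym operator_matrix_1_rotation mat3_mult mat3_index f by simp
  ultimately show "\<exists>q. Q = mat3 0 0 0 0 q 0 0 0 q"
    unfolding Q sym by blast
next
  assume "\<exists>q. Q = mat3 0 0 0 0 q 0 0 0 q"
  then obtain q where Q: "Q = mat3 0 0 0 0 q 0 0 0 q" ..
  have "Q \<in> carrier_mat 3 3"
    unfolding Q by (rule mat3_carrier)
  then show "extended_range 1 Q"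
    unfolding extended_range_def Let_def num_modes_1 operator_matrix_1_partial_x Q
      operator_matrix_1_partial_y operator_matrix_1_rotation operator_matrix_1_reflection
      mat3_transpose mat3_mult mat3_add mat3_zero mat3_eq_iff
    by simp
qed

section \<open>Positive definiteness of diagonal matrices\<close>

lemma positive_definite_diag3_iff:
  "positive_definite (mat3 a 0 0 0 b 0 0 0 c) \<longleftrightarrow> 0 < a \<and> 0 < b \<and> 0 < c"
proof -
  let ?A = "mat3 a 0 0 0 b 0 0 0 c"
  have dim: "dim_row ?A = 3" "dim_col ?A = 3"
    using mat3_carrier[of a 0 0 0 b 0 0 0 c] by auto
  have three: "{0..<3} = {0, 1, 2::nat}" by auto
  have quad: "scalar_prod v (?A *\<^sub>v v) =
      a * (vec_index v 0)\<^sup>2 + b * (vec_index v 1)\<^sup>2 + c * (vec_index v 2)\<^sup>2"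
    if "v \<in> carrier_vec 3" for v
    using that by (simp add: scalar_prod_def three mat_of_rows_list_def numeral_2_eq_2)
  have pd: "positive_definite ?A \<longleftrightarrow> (\<forall>v \<in> carrier_vec 3. v \<noteq> 0\<^sub>v 3 \<longrightarrow>
      0 < a * (vec_index v 0)\<^sup>2 + b * (vec_index v 1)\<^sup>2 + c * (vec_index v 2)\<^sup>2)"
    unfolding positive_definite_def mat3_transpose dim using quad by (auto simp: dim)
  show ?thesis
  proof
    assume "positive_definite ?A"
    then have pd': "0 < a * (vec_index v 0)\<^sup>2 + b * (vec_index v 1)\<^sup>2 + c * (vec_index v 2)\<^sup>2"
      if "v \<in> carrier_vec 3" "v \<noteq> 0\<^sub>v 3" for v
      using that unfolding pd by blast
    have *: "0 < a * (vec_index (unit_vec 3 i) 0)\<^sup>2 + b * (vec_index (unit_vec 3 i) 1)\<^sup>2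
        + c * (vec_index (unit_vec 3 i) 2)\<^sup>2" if "i < 3" for i
      using that by (intro pd') simp_all
    show "0 < a \<and> 0 < b \<and> 0 < c"
      using *[of 0] *[of 1] *[of 2] by simp
  next
    assume pos: "0 < a \<and> 0 < b \<and> 0 < c"
    show "positive_definite ?A"
      unfolding pd
    proof (intro ballI impI)
      fix v :: "real vec"
      assume v: "v \<in> carrier_vec 3" "v \<noteq> 0\<^sub>v 3"
      have "vec_index v 0 \<noteq> 0 \<or> vec_index v 1 \<noteq> 0 \<or> vec_index v 2 \<noteq> 0"
      proof (rule ccontr)
        assume "\<not> ?thesis"
        then have "v = 0\<^sub>v 3"
          using v(1) by (intro eq_vecI) (auto simp: less_3_cases)
        with v(2) show False ..
      qed
      moreover have "0 \<le> a * (vec_index v 0)\<^sup>2" "0 \<le> b * (vec_index v 1)\<^sup>2" "0 \<le> c * (vec_index v 2)\<^sup>2"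
        using pos by simp_all
      moreover have "0 < a * (vec_index v 0)\<^sup>2" if "vec_index v 0 \<noteq> 0"
        using pos that by simp
      moreover have "0 < b * (vec_index v 1)\<^sup>2" if "vec_index v 1 \<noteq> 0"
        using pos that by simp
      moreover have "0 < c * (vec_index v 2)\<^sup>2" if "vec_index v 2 \<noteq> 0"
        using pos that by simp
      ultimately show "0 < a * (vec_index v 0)\<^sup>2 + b * (vec_index v 1)\<^sup>2 + c * (vec_index v 2)\<^sup>2"
        by (smt (verit))
    qed
  qed
qed

section \<open>Correction matrices\<close>

lemma centroid_eq: "centroid = (0, 0)"
  unfolding centroid_def vertex_simps by simp

lemma edge_vector:
  "vertex (Suc 0) - vertex 0 = (2, 0)" "vertex (Suc 1) - vertex 1 = (- 1, sqrt 3)"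
  "vertex (Suc 2) - vertex 2 = (- 1, - sqrt 3)"
  using vertex_simps by (simp_all add: numeral_2_eq_2 numeral_3_eq_3 field_simps)

lemma edge_length_eq: "e < 3 \<Longrightarrow> edge_length e = 2"
  unfolding less_3_cases edge_length_def dist_norm norm_minus_commute[of "vertex e" "vertex (Suc e)"]
  by (elim disjE; simp only: edge_vector) (simp_all add: norm_Pair)

lemma outward_normal_simps:
  "outward_normal 0 = (0, - 1)" "outward_normal 1 = (sqrt 3 / 2, 1 / 2)"
  "outward_normal 2 = (- sqrt 3 / 2, 1 / 2)"
  using edge_length_eq[of 0] edge_length_eq[of 1] edge_length_eq[of 2]
  unfolding outward_normal_def Let_def edge_vector by simp_all

lemma edge_point_eq: "edge_point e t = vertex e + t *\<^sub>R (vertex (Suc e) - vertex e)"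
  by (simp add: edge_point_def algebra_simps)

lemma edge_point_simps:
  "edge_point 0 t = (2 * t - 1, - (sqrt 3 / 3))" "edge_point 1 t = (1 - t, sqrt 3 * t - sqrt 3 / 3)"
  "edge_point 2 t = (- t, 2 * sqrt 3 / 3 - sqrt 3 * t)"
  unfolding edge_point_eq edge_vector unfolding vertex_simps by simp_all

lemma edge_point_inject: "e < 3 \<Longrightarrow> edge_point e t = edge_point e t' \<longleftrightarrow> t = t'"
  unfolding less_3_cases by (elim disjE; simp only: edge_point_simps) auto

lemma affine_fun_edge_point: "affine_fun a b c (edge_point e t) =
    (1 - t) * affine_fun a b c (vertex e) + t * affine_fun a b c (vertex (Suc e))"
  unfolding edge_point_def
  by (cases "vertex e"; cases "vertex (Suc e)") (simp add: algebra_simps)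

text \<open>The weights 2, 1, 1, 2 over 6 form the mass matrix of linear interpolation on the unit
  interval; \<open>r\<close> will be the edge length.\<close>

lemma integral_product_affine:
  "integral {0..1} (\<lambda>t. ((1 - t) * a + t * b) * ((1 - t) * p + t * q) * r) =
    r * (2 * a * p + a * q + b * p + 2 * b * q) / (6 :: real)"
proof (rule integral_unique)
  define F where "F t = r * (a * p * (t - t\<^sup>2 + t ^ 3 / 3) + (a * q + b * p) * (t\<^sup>2 / 2 - t ^ 3 / 3)
    + b * q * t ^ 3 / 3)" for t
  have "((\<lambda>t. ((1 - t) * a + t * b) * ((1 - t) * p + t * q) * r) has_integral F 1 - F 0) {0..1}"
    unfolding F_def
    by (rule fundamental_theorem_of_calculus)
      (auto intro!: derivative_eq_intros simp flip: has_real_derivative_iff_has_vector_derivative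
        simp: power2_eq_square field_simps)
  also have "F 1 - F 0 = r * (2 * a * p + a * q + b * p + 2 * b * q) / 6"
    by (simp add: F_def field_simps)
  finally show "((\<lambda>t. ((1 - t) * a + t * b) * ((1 - t) * p + t * q) * r) has_integral
      r * (2 * a * p + a * q + b * p + 2 * b * q) / 6) {0..1}" .
qed

section \<open>Raviart-Thomas fields vanishing at the centroid\<close>

text \<open>In the notation of the overview, \<open>a\<close>, \<open>b\<close>, \<open>c\<close>,
  \<open>d\<close> are the entries of the matrix \<open>A\<close>, and \<open>(u, v)\<close> is the
  vector \<open>b\<close>.\<close>

definition rt_field :: "real \<Rightarrow> real \<Rightarrow> real \<Rightarrow> real \<Rightarrow> real \<Rightarrow> real \<Rightarrow> real \<times> real \<Rightarrow> real \<times> real" where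
  "rt_field a b c d u v = (\<lambda>(x, y). (a * x + b * y + (u * x + v * y) * x, c * x + d * y + (u * x + v * y) * y))"

text \<open>The centroid is the origin, so vanishing there removes exactly the constant parts of the
  two affine components.\<close>

lemma raviart_thomas_1_centroid_iff:
  "h \<in> raviart_thomas 1 \<and> fst (h centroid) = 0 \<and> snd (h centroid) = 0 \<longleftrightarrow>
    (\<exists>a b c d u v. h = rt_field a b c d u v)" (is "?L \<longleftrightarrow> ?R")
proof
  define r where "r = sqrt 2 * root3"
  have r: "r > 0" using root3_pos by (simp add: r_def)
  have S: "(\<Sum>v\<le>1. c v * dubiner 1 (dubiner_index 1 v (1 - v)) z) = c 0 * affine_fun 0 0 r z + c 1 * affine_fun 0 r 0 z"
    for c :: "nat \<Rightarrow> real" and z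
  proof -
    have idx: "dubiner_index 1 0 (1 - 0) = 2" "dubiner_index 1 1 (1 - 1) = 3"
      by (simp_all add: dubiner_index_def)
    have "(\<Sum>v\<le>1. f v) = f 0 + f 1" for f :: "nat \<Rightarrow> real"
      by simp
    then show ?thesis
      by (simp only: idx dubiner_1_2 dubiner_1_3 r_def)
  qed
  {
    assume ?L
    then obtain p q c where "p \<in> poly_space 1" "q \<in> poly_space 1"
      and h: "\<And>z. h z = (p z, q z) + (\<Sum>v\<le>1. c v * dubiner 1 (dubiner_index 1 v (1 - v)) z) *\<^sub>R z"
      and h0: "fst (h (0, 0)) = 0" "snd (h (0, 0)) = 0"
      unfolding raviart_thomas_def centroid_eq by blast
    then obtain p0 p1 p2 q0 q1 q2 where pq: "p = affine_fun p0 p1 p2" "q = affine_fun q0 q1 q2"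
      unfolding poly_space_1 by blast
    have "p0 = 0" "q0 = 0"
      using h0 unfolding h pq by simp_all
    \<comment> \<open>The summand with index 0 is the \<open>y\<close> mode, so \<open>c 0\<close>
      yields the last parameter and \<open>c 1\<close> the one before it.\<close>
    then have "h = rt_field p1 p2 q1 q2 (c 1 * r) (c 0 * r)"
      unfolding fun_eq_iff h pq S by (auto simp: rt_field_def algebra_simps)
    then show ?R by blast
  }
  {
    assume ?R
    then obtain a b c d u v where h: "h = rt_field a b c d u v" by blast
    \<comment> \<open>Dividing by \<open>r\<close> undoes the scaling of the two linear
      modes.\<close>
    have "h z = (affine_fun 0 a b z, affine_fun 0 c d z) +
        (\<Sum>i\<le>1. (if i = 0 then v / r else u / r) * dubiner 1 (dubiner_index 1 i (1 - i)) z) *\<^sub>R z" for z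
      unfolding h S using r by (cases z) (simp add: rt_field_def algebra_simps)
    then have "\<exists>p\<in>poly_space 1. \<exists>q\<in>poly_space 1. \<exists>c. \<forall>z.
        h z = (p z, q z) + (\<Sum>v\<le>1. c v * dubiner 1 (dubiner_index 1 v (1 - v)) z) *\<^sub>R z"
      by (intro bexI[of _ "affine_fun 0 a b"] bexI[of _ "affine_fun 0 c d"]
          exI[of _ "\<lambda>i. if i = 0 then v / r else u / r"] allI) (unfold poly_space_1, blast+)
    then have "h \<in> raviart_thomas 1"
      unfolding raviart_thomas_def by blast
    then show ?L
      by (simp add: h centroid_eq rt_field_def)
  }
qed

text \<open>The factor 3 is the dimension 2 plus the degree 1 of the form
  \<open>u * x + v * y\<close>, by Euler's identity.\<close>

lemma divergence_rt_field: "divergence (rt_field a b c d u v) = affine_fun (a + d) (3 * u) (3 * v)"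
proof -
  have "partial_x (\<lambda>z. fst (rt_field a b c d u v z)) (x, y) = a + 2 * u * x + v * y"
    "partial_y (\<lambda>z. snd (rt_field a b c d u v z)) (x, y) = d + u * x + 2 * v * y" for x y
    by (auto simp: partial_x_def partial_y_def rt_field_def algebra_simps
        intro!: DERIV_imp_deriv derivative_eq_intros)
  then show ?thesis
    by (auto simp: divergence_def fun_eq_iff)
qed

text \<open>The inner product of the position vector with the normal is constant along an edge, so
  even the quadratic part has an affine normal component. The coefficients of \<open>1 - t\<close>
  and \<open>t\<close> are its values at the two ends.\<close>

lemma rt_field_flux:
  fixes a b c d u v t :: real
  defines "flux \<equiv> \<lambda>e t. inner (rt_field a b c d u v (edge_point e t)) (outward_normal e)"
  shows "flux 0 t = (1 - t) * (c + sqrt 3 / 3 * d - sqrt 3 / 3 * u - v / 3)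
      + t * (- c + sqrt 3 / 3 * d + sqrt 3 / 3 * u - v / 3)"
    and "flux 1 t = (1 - t) * (sqrt 3 / 2 * a - b / 2 + c / 2 - sqrt 3 / 6 * d + sqrt 3 / 3 * u - v / 3)
      + t * (b + sqrt 3 / 3 * d + 2 / 3 * v)"
    and "flux 2 t = (1 - t) * (- b + sqrt 3 / 3 * d + 2 / 3 * v)
      + t * (sqrt 3 / 2 * a + b / 2 - c / 2 - sqrt 3 / 6 * d - sqrt 3 / 3 * u - v / 3)"
proof -
  define s :: real where "s = sqrt 3"
  have s: "s * s = 3" by (simp add: s_def)
  have ss: "s * (s * x) = 3 * x" for x
    using s by (simp flip: mult.assoc)
  show "flux 0 t = (1 - t) * (c + sqrt 3 / 3 * d - sqrt 3 / 3 * u - v / 3)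
      + t * (- c + sqrt 3 / 3 * d + sqrt 3 / 3 * u - v / 3)"
    "flux 1 t = (1 - t) * (sqrt 3 / 2 * a - b / 2 + c / 2 - sqrt 3 / 6 * d + sqrt 3 / 3 * u - v / 3)
      + t * (b + sqrt 3 / 3 * d + 2 / 3 * v)"
    "flux 2 t = (1 - t) * (- b + sqrt 3 / 3 * d + 2 / 3 * v)
      + t * (sqrt 3 / 2 * a + b / 2 - c / 2 - sqrt 3 / 6 * d - sqrt 3 / 3 * u - v / 3)"
    unfolding flux_def edge_point_simps outward_normal_simps s_def[symmetric] rt_field_def prod.case inner_Pair inner_real_def
    by (simp_all add: field_simps s ss)
qed

text \<open>Explicit inversion of the linear system given by \<open>rt_field_flux\<close>: the six
  end values of the normal components, \<open>p e\<close> at the start and \<open>q e\<close> at the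
  end of edge \<open>e\<close>, determine the six coefficients.\<close>

lemma rt_field_flux_iff:
  "(\<forall>e<3. \<forall>t. inner (rt_field a b c d u v (edge_point e t)) (outward_normal e) = (1 - t) * p e + t * q e) \<longleftrightarrow>
    a = sqrt 3 / 6 * (2 * p 1 + q 1 + p 2 + 2 * q 2) \<and>
    b = (q 1 - p 2) / 2 \<and>
    c = (2 * p 0 - 2 * q 0 + 2 * p 1 + q 1 - p 2 - 2 * q 2) / 6 \<and>
    d = sqrt 3 / 6 * (2 * p 0 + 2 * q 0 + q 1 + p 2) \<and>
    u = sqrt 3 / 6 * (q 0 - p 0 + 2 * p 1 + q 1 - p 2 - 2 * q 2) \<and>
    v = (- p 0 - q 0 + q 1 + p 2) / 2" (is "?L \<longleftrightarrow> ?R")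
proof -
  define s :: real where "s = sqrt 3"
  have s: "s * s = 3" by (simp add: s_def)
  have ss: "s * (s * x) = 3 * x" for x
    using s by (simp flip: mult.assoc)
  \<comment> \<open>Affine functions of \<open>t\<close> are compared by their values at 0 and 1,
    which turns the condition on all \<open>t\<close> into six equations.\<close>
  have cong: "(\<forall>t::real. (1 - t) * x + t * y = (1 - t) * x' + t * y') \<longleftrightarrow> x = x' \<and> y = y'" for x y x' y'
  proof
    assume *: "\<forall>t. (1 - t) * x + t * y = (1 - t) * x' + t * y'"
    show "x = x' \<and> y = y'"
      using *[rule_format, of 0] *[rule_format, of 1] by simp
  qed simp
  have all3: "(\<forall>e<3. P e) \<longleftrightarrow> P 0 \<and> P 1 \<and> P 2" for P :: "nat \<Rightarrow> bool"
    by (auto simp: less_3_cases)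
  have "?L \<longleftrightarrow>
      c + s / 3 * d - s / 3 * u - v / 3 = p 0 \<and>
      - c + s / 3 * d + s / 3 * u - v / 3 = q 0 \<and>
      s / 2 * a - b / 2 + c / 2 - s / 6 * d + s / 3 * u - v / 3 = p 1 \<and>
      b + s / 3 * d + 2 / 3 * v = q 1 \<and>
      - b + s / 3 * d + 2 / 3 * v = p 2 \<and>
      s / 2 * a + b / 2 - c / 2 - s / 6 * d - s / 3 * u - v / 3 = q 2" (is "_ \<longleftrightarrow> ?M")
    by (simp only: all3 rt_field_flux cong s_def conj_assoc)
  also have "?M \<longleftrightarrow> ?R"
  proof
    assume M: ?M
    then have pq: "p 0 = c + s / 3 * d - s / 3 * u - v / 3"
      "q 0 = - c + s / 3 * d + s / 3 * u - v / 3"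
      "p 1 = s / 2 * a - b / 2 + c / 2 - s / 6 * d + s / 3 * u - v / 3"
      "q 1 = b + s / 3 * d + 2 / 3 * v"
      "p 2 = - b + s / 3 * d + 2 / 3 * v"
      "q 2 = s / 2 * a + b / 2 - c / 2 - s / 6 * d - s / 3 * u - v / 3"
      by linarith+
    show ?R
      unfolding s_def[symmetric] pq by (simp add: field_simps s ss)
  next
    assume R: ?R
    then have abc: "a = s / 6 * (2 * p 1 + q 1 + p 2 + 2 * q 2)" "b = (q 1 - p 2) / 2"
      "c = (2 * p 0 - 2 * q 0 + 2 * p 1 + q 1 - p 2 - 2 * q 2) / 6"
      "d = s / 6 * (2 * p 0 + 2 * q 0 + q 1 + p 2)"
      "u = s / 6 * (q 0 - p 0 + 2 * p 1 + q 1 - p 2 - 2 * q 2)"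
      "v = (- p 0 - q 0 + q 1 + p 2) / 2"
      unfolding s_def by blast+
    show ?M
      unfolding abc by (simp add: field_simps s ss)
  qed
  finally show ?thesis .
qed

section \<open>Flux points and the prescribed normal components\<close>

lemma flux_edge_1: "flux_edge 1 j = j div 2"
  by (simp add: flux_edge_def numeral_2_eq_2)

text \<open>States the affinity through the function's own end values, as \<open>affine_eqI\<close>
  expects it.\<close>

lemma rt_field_flux_affine:
  fixes a b c d u v t :: real
  assumes "e < 3"
  defines "flux \<equiv> \<lambda>t. inner (rt_field a b c d u v (edge_point e t)) (outward_normal e)"
  shows "flux t = (1 - t) * flux 0 + t * flux 1"
  using assms(1) unfolding flux_def less_3_cases
  by (elim disjE; simp only: rt_field_flux) simp_all

lemma affine_eqI:
  assumes F: "\<And>t. F t = (1 - t) * F 0 + t * F (1 :: real)" and G: "\<And>t. G t = (1 - t) * G 0 + t * G 1"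
    and "F x = G x" "F y = G y" "x \<noteq> y"
  shows "F t = (G t :: real)"
proof -
  define D where "D = (\<lambda>t. F t - G t)"
  have D: "D t = D 0 + t * (D 1 - D 0)" for t
    unfolding D_def F[of t] G[of t] by (simp add: algebra_simps)
  have "D x = 0" "D y = 0"
    using assms(3,4) by (simp_all add: D_def)
  then have "(x - y) * (D 1 - D 0) = 0"
    using D[of x] D[of y] by (simp add: algebra_simps)
  then have "D 1 = D 0" using assms(5) by simp
  then have "D 0 = 0" using D[of x] \<open>D x = 0\<close> by simp
  then have "D t = 0" using D[of t] \<open>D 1 = D 0\<close> by simp
  then show ?thesis by (simp add: D_def)
qed

locale flux_configuration =
  fixes P :: "nat \<Rightarrow> real \<times> real"
  assumes flux_points: "flux_points 1 P"
begin

text \<open>The edge parameter of a flux point. Existence is \<open>edge_point_param\<close>, and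
  uniqueness follows from \<open>edge_point_inject\<close>.\<close>

definition param :: "nat \<Rightarrow> real" where
  "param j = (SOME t. P j = edge_point (j div 2) t)"

text \<open>Edge \<open>e\<close> carries the flux points \<open>2 * e\<close> and
  \<open>2 * e + 1\<close>; this map exchanges them.\<close>

definition partner :: "nat \<Rightarrow> nat" where
  "partner j = (if even j then Suc j else j - 1)"

lemma partner: "j < 6 \<Longrightarrow> partner j < 6" "partner j div 2 = j div 2" "partner j \<noteq> j"
  "i div 2 = j div 2 \<Longrightarrow> i = j \<or> i = partner j"
  unfolding partner_def by presburger+

lemma edge_point_param:
  assumes "j < 6"
  shows "P j = edge_point (j div 2) (param j)"
proof -
  have "P j \<in> closed_segment (vertex (j div 2)) (vertex (Suc (j div 2)))"
    using flux_points assms unfolding flux_points_def flux_edge_1 by simp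
  then have "\<exists>t. P j = edge_point (j div 2) t"
    unfolding closed_segment_def edge_point_def by blast
  then show ?thesis
    unfolding param_def by (rule someI_ex)
qed

lemma edge_point_eq_iff_param:
  assumes "j < 6"
  shows "edge_point (j div 2) t = P j \<longleftrightarrow> t = param j"
  using assms edge_point_inject[of "j div 2"] unfolding edge_point_param[OF assms] by simp

text \<open>Distinctness of the flux points on an edge enters here; it keeps the Lagrange
  denominators nonzero.\<close>

lemma param_partner:
  assumes j: "j < 6"
  shows "param (partner j) \<noteq> param j"
proof
  assume eq: "param (partner j) = param j"
  have PP: "P (partner j) = P j"
    using edge_point_param[OF j] edge_point_param[OF partner(1)[OF j]] eq partner(2)[of j] by simp
  have inj: "inj_on P {i. i < 3 * (1 + 1) \<and> flux_edge 1 i = j div 2}"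
    using flux_points j unfolding flux_points_def by (simp add: less_mult_imp_div_less)
  have "partner j = j"
    by (rule inj_onD[OF inj PP])
      (use partner(1)[OF j] partner(2)[of j] j in \<open>simp_all add: flux_edge_1[unfolded One_nat_def]\<close>)
  then show False
    using partner(3)[of j] by contradiction
qed

text \<open>The condition in \<open>flux_lagrange\<close> reduces to the values at two distinct
  nodes (\<open>cond\<close>), which fix a polynomial of degree at most 1.\<close>

lemma poly_flux_lagrange:
  assumes j: "j < 6"
  shows "poly (flux_lagrange 1 P j) t = (t - param (partner j)) / (param j - param (partner j))"
proof -
  define \<tau> \<sigma> where "\<tau> = param j" and "\<sigma> = param (partner j)"
  have ne: "\<tau> \<noteq> \<sigma>"
    using param_partner[OF j] by (simp add: \<tau>_def \<sigma>_def)
  define l where "l = [:- \<sigma> / (\<tau> - \<sigma>), 1 / (\<tau> - \<sigma>):]"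
  have l: "poly l t = (t - \<sigma>) / (\<tau> - \<sigma>)" for t
    by (simp add: l_def diff_divide_distrib)
  have cond: "(\<forall>i < 3 * (1 + 1). \<forall>t. flux_edge 1 i = flux_edge 1 j \<and> edge_point (flux_edge 1 j) t = P i
      \<longrightarrow> poly q t = (if i = j then 1 else 0)) \<longleftrightarrow> poly q \<tau> = 1 \<and> poly q \<sigma> = 0" (is "?L \<longleftrightarrow> ?R") for q
  proof
    assume L: ?L
    show ?R
      using L[rule_format, of j \<tau>] L[rule_format, of "partner j" \<sigma>] j partner(1-3)[of j]
        edge_point_param[of j] edge_point_param[of "partner j"]
      unfolding flux_edge_1 \<tau>_def \<sigma>_def by simp
  next
    assume R: ?R
    show ?L
    proof (intro allI impI)
      fix i t
      assume i: "i < 3 * (1 + 1)"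
        and e: "flux_edge 1 i = flux_edge 1 j \<and> edge_point (flux_edge 1 j) t = P i"
      then have "t = param i"
        using edge_point_eq_iff_param[of i t] unfolding flux_edge_1 by simp
      moreover have "i = j \<or> i = partner j"
        using e unfolding flux_edge_1 by (intro partner(4)) simp
      ultimately show "poly q t = (if i = j then 1 else 0)"
        using R partner(3)[of j] by (auto simp: \<tau>_def \<sigma>_def)
    qed
  qed
  have "flux_lagrange 1 P j = l"
    unfolding flux_lagrange_def cond
  proof (rule the_equality)
    show "degree l \<le> 1 \<and> poly l \<tau> = 1 \<and> poly l \<sigma> = 0"
      using ne by (simp add: l) (simp add: l_def)
  next
    fix q
    assume q: "degree q \<le> 1 \<and> poly q \<tau> = 1 \<and> poly q \<sigma> = 0"
    have "card {\<tau>, \<sigma>} = 2" using ne by simp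
    moreover have "degree l \<le> 1" by (simp add: l_def)
    ultimately show "q = l"
      using q ne by (intro poly_eqI_degree[of "{\<tau>, \<sigma>}"]) (auto simp: l)
  qed
  then show ?thesis by (simp add: l \<tau>_def \<sigma>_def)
qed

text \<open>The normal component that the SD correction for flux point \<open>j\<close> must have
  along the whole of edge \<open>e\<close>.\<close>

definition edge_values :: "nat \<Rightarrow> nat \<Rightarrow> real \<Rightarrow> real" where
  "edge_values j e t = (if e = j div 2 then poly (flux_lagrange 1 P j) t else 0)"

lemma edge_values_affine:
  "j < 6 \<Longrightarrow> edge_values j e t = (1 - t) * edge_values j e 0 + t * edge_values j e 1"
  using param_partner[of j] unfolding edge_values_def
  by (simp only: poly_flux_lagrange split: if_split) (simp add: divide_inverse algebra_simps)

lemma edge_values_param: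
  assumes "j < 6" "i < 6"
  shows "edge_values j (i div 2) (param i) = (if i = j then 1 else 0)"
  using partner(2,3)[of j] partner(4)[of i j] param_partner[of j] assms(1)
  unfolding edge_values_def poly_flux_lagrange[OF assms(1)] by auto

text \<open>Both sides are affine along each edge and two distinct flux points lie on it, so the six
  point conditions already prescribe the normal component everywhere on the boundary. The result has
  the shape required by \<open>rt_field_flux_iff\<close>.\<close>

lemma sd_flux_iff:
  assumes j: "j < 6"
  shows "(\<forall>i < 3 * (1 + 1). inner (rt_field a b c d u v (P i)) (outward_normal (flux_edge 1 i)) =
      (if i = j then 1 else 0)) \<longleftrightarrow>
    (\<forall>e<3. \<forall>t. inner (rt_field a b c d u v (edge_point e t)) (outward_normal e) =
      (1 - t) * edge_values j e 0 + t * edge_values j e 1)" (is "?L \<longleftrightarrow> ?R")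
proof
  let ?F = "\<lambda>e t. inner (rt_field a b c d u v (edge_point e t)) (outward_normal e)"
  {
    assume L: ?L
    have val: "?F (i div 2) (param i) = edge_values j (i div 2) (param i)" if "i < 6" for i
      using L[rule_format, of i] that edge_values_param[OF j that] edge_point_param[OF that]
      unfolding flux_edge_1 by simp
    show ?R
    proof (intro allI impI)
      fix e :: nat and t :: real
      assume e: "e < 3"
      \<comment> \<open>The first flux point on edge \<open>e\<close>; its partner is the
        second.\<close>
      define i where "i = 2 * e"
      have i: "i < 6" "i div 2 = e" using e by (simp_all add: i_def)
      have "?F e t = edge_values j e t"
      proof (rule affine_eqI[where F = "?F e" and G = "edge_values j e"])
        show "?F e (param i) = edge_values j e (param i)"
          using val[OF i(1)] unfolding i(2) .
        show "?F e (param (partner i)) = edge_values j e (param (partner i))"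
          using val[OF partner(1)[OF i(1)]] unfolding partner(2) i(2) .
        show "param i \<noteq> param (partner i)"
          using param_partner[OF i(1)] by simp
      qed (rule rt_field_flux_affine[OF e] edge_values_affine[OF j])+
      then show "?F e t = (1 - t) * edge_values j e 0 + t * edge_values j e 1"
        using edge_values_affine[OF j] by metis
    qed
  }
  {
    assume R: ?R
    show ?L
    proof (intro allI impI)
      fix i :: nat
      assume i: "i < 3 * (1 + 1)"
      then have "?F (i div 2) (param i) = edge_values j (i div 2) (param i)"
        using R edge_values_affine[OF j, of "i div 2" "param i"] by simp
      then show "inner (rt_field a b c d u v (P i)) (outward_normal (flux_edge 1 i)) = (if i = j then 1 else 0)"
        using i edge_values_param[OF j, of i] edge_point_param[of i] unfolding flux_edge_1 by simp
    qed
  }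
qed

text \<open>The two equivalences \<open>sd_flux_iff\<close> and \<open>rt_field_flux_iff\<close>
  turn the flux conditions into formulas for the six coefficients, which settles existence and
  uniqueness for the \<open>THE\<close> at once.\<close>

lemma sd_correction_1:
  fixes j :: nat
  assumes j: "j < 6"
  defines "p \<equiv> \<lambda>e. edge_values j e 0" and "q \<equiv> \<lambda>e. edge_values j e 1"
  shows "sd_correction 1 P {centroid} j = rt_field
    (sqrt 3 / 6 * (2 * p 1 + q 1 + p 2 + 2 * q 2)) ((q 1 - p 2) / 2)
    ((2 * p 0 - 2 * q 0 + 2 * p 1 + q 1 - p 2 - 2 * q 2) / 6)
    (sqrt 3 / 6 * (2 * p 0 + 2 * q 0 + q 1 + p 2))
    (sqrt 3 / 6 * (q 0 - p 0 + 2 * p 1 + q 1 - p 2 - 2 * q 2))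
    ((- p 0 - q 0 + q 1 + p 2) / 2)" (is "_ = ?h")
  unfolding sd_correction_def
proof (rule the_equality)
  note iff = sd_flux_iff[OF j, unfolded rt_field_flux_iff]
  show "?h \<in> raviart_thomas 1 \<and>
    (\<forall>i < 3 * (1 + 1). inner (?h (P i)) (outward_normal (flux_edge 1 i)) = (if i = j then 1 else 0)) \<and>
    (\<forall>z\<in>{centroid}. fst (?h z) = 0 \<and> snd (?h z) = 0)"
    using raviart_thomas_1_centroid_iff[of ?h] unfolding iff p_def q_def by blast
next
  note iff = sd_flux_iff[OF j, unfolded rt_field_flux_iff]
  fix h
  assume h: "h \<in> raviart_thomas 1 \<and>
    (\<forall>i < 3 * (1 + 1). inner (h (P i)) (outward_normal (flux_edge 1 i)) = (if i = j then 1 else 0)) \<and>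
    (\<forall>z\<in>{centroid}. fst (h z) = 0 \<and> snd (h z) = 0)"
  then obtain a b c d u v where hd: "h = rt_field a b c d u v"
    using raviart_thomas_1_centroid_iff[of h] by blast
  show "h = ?h"
    using h unfolding hd iff p_def q_def by blast
qed

section \<open>Entries of the correction matrices\<close>

text \<open>The denominator 3 is the 6 of \<open>integral_product_affine\<close> divided by the edge
  length 2.\<close>

lemma dg_boundary_affine:
  assumes j: "j < 6"
  defines "e \<equiv> j div 2"
  shows "integral {0..1} (\<lambda>t. affine_fun a b c (edge_point (flux_edge 1 j) t)
      * poly (flux_lagrange 1 P j) t * edge_length (flux_edge 1 j)) =
    (2 * affine_fun a b c (vertex e) * edge_values j e 0 + affine_fun a b c (vertex e) * edge_values j e 1
     + affine_fun a b c (vertex (Suc e)) * edge_values j e 0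
     + 2 * affine_fun a b c (vertex (Suc e)) * edge_values j e 1) / 3"
proof -
  have e: "flux_edge 1 j = e" "e < 3"
    using j unfolding flux_edge_1 e_def by simp_all
  have "poly (flux_lagrange 1 P j) t = (1 - t) * edge_values j e 0 + t * edge_values j e 1" for t
    using edge_values_affine[OF j, of e t] by (simp add: edge_values_def e_def)
  then show ?thesis
    unfolding e(1) affine_fun_edge_point edge_length_eq[OF e(2)]
    by (simp only: integral_product_affine)
qed

lemma C_SD_index:
  assumes m: "m < 3" and j: "j < 6"
  defines "p \<equiv> \<lambda>e. edge_values j e 0" and "q \<equiv> \<lambda>e. edge_values j e 1"
  shows "C_SD 1 P {centroid} $$ (m, j) =
    [root3 * (sqrt 3 / 3 * (p 0 + q 0 + p 1 + q 1 + p 2 + q 2)),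
     3 / 2 * (q 1 + p 2 - p 0 - q 0) / (sqrt 2 * root3),
     sqrt 3 / 2 * (q 0 - p 0 + 2 * p 1 + q 1 - p 2 - 2 * q 2) / (sqrt 2 * root3)] ! m"
proof -
  have "C_SD 1 P {centroid} $$ (m, j) =
      vec_index (modal_coeffs 1 (divergence (sd_correction 1 P {centroid} j))) m"
    using m j unfolding C_SD_def num_modes_1 by simp
  also have "\<dots> = [root3 * (sqrt 3 / 3 * (p 0 + q 0 + p 1 + q 1 + p 2 + q 2)),
     3 / 2 * (q 1 + p 2 - p 0 - q 0) / (sqrt 2 * root3),
     sqrt 3 / 2 * (q 0 - p 0 + 2 * p 1 + q 1 - p 2 - 2 * q 2) / (sqrt 2 * root3)] ! m"
    unfolding sd_correction_1[OF j] divergence_rt_field modal_coeffs_1 vec_of_list_index p_def q_def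
    by (intro arg_cong[of _ _ "\<lambda>xs. xs ! m"]) (simp add: algebra_simps add_divide_distrib diff_divide_distrib)
  finally show ?thesis .
qed

text \<open>Only the edge carrying \<open>j\<close> contributes, so \<open>p\<close> and
  \<open>q\<close> are single numbers here. Second coordinates come before first ones, following the
  order of the modes.\<close>

lemma dg_boundary_matrix_index:
  assumes m: "m < 3" and j: "j < 6"
  defines "e \<equiv> j div 2"
  defines "p \<equiv> edge_values j e 0" and "q \<equiv> edge_values j e 1"
  shows "dg_boundary_matrix 1 P $$ (m, j) =
    [(p + q) / root3,
     sqrt 2 * root3 * ((2 * p + q) * snd (vertex e) + (p + 2 * q) * snd (vertex (Suc e))) / 3,
     sqrt 2 * root3 * ((2 * p + q) * fst (vertex e) + (p + 2 * q) * fst (vertex (Suc e))) / 3] ! m"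
proof -
  have "dg_boundary_matrix 1 P $$ (m, j) = integral {0..1} (\<lambda>t. dubiner 1 (m + 1)
      (edge_point (flux_edge 1 j) t) * poly (flux_lagrange 1 P j) t * edge_length (flux_edge 1 j))"
    using m j unfolding dg_boundary_matrix_def num_modes_1 by simp
  then show ?thesis
    using m unfolding less_3_cases
    by (elim disjE; simp only: dubiner_1 dg_boundary_affine[OF j, folded e_def] p_def[symmetric] q_def[symmetric];
        cases "vertex e"; cases "vertex (Suc e)")
      (simp_all add: algebra_simps add_divide_distrib)
qed

text \<open>The factor is \<open>1 + q\<close> for the diagonal entry \<open>q\<close> of the matrix
  with \<open>1 / 3\<close>: 1 in the constant mode and \<open>4 / 3\<close> in the linear modes. It
  is checked for each edge and each mode.\<close>

lemma C_SD_eq_dg_boundary_matrix: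
  assumes m: "m < 3" and j: "j < 6"
  shows "(if m = 0 then 1 else 4 / 3) * C_SD 1 P {centroid} $$ (m, j) = dg_boundary_matrix 1 P $$ (m, j)"
proof -
  define e where "e = j div 2"
  define p where "p = edge_values j e 0"
  define q where "q = edge_values j e 1"
  define r where "r = root3"
  define s :: real where "s = sqrt 3"
  define w :: real where "w = sqrt 2"
  have pos: "r > 0" "w > 0"
    using root3_pos by (simp_all add: r_def w_def)
  have sq: "r * r = s" "s * s = 3" "w * w = 2"
    using root3_sq by (simp_all add: r_def s_def w_def)
  have sq': "r * (r * x) = s * x" "s * (s * x) = 3 * x" "w * (w * x) = 2 * x" for x
    using sq by (simp_all flip: mult.assoc)
  have "e < 3"
    using j by (simp add: e_def)
  then have "e = 0 \<or> e = 1 \<or> e = 2"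
    by (simp only: less_3_cases)
  \<comment> \<open>End values on the other two edges vanish, so the sums over all edges in
    \<open>C_SD_index\<close> collapse to the terms of edge \<open>e\<close>.\<close>
  moreover have v: "edge_values j i t = (if i = e then edge_values j e t else 0)" for i t
    by (simp add: edge_values_def e_def)
  have v': "edge_values j i 0 = (if i = e then p else 0)" "edge_values j i 1 = (if i = e then q else 0)" for i
    using v unfolding p_def q_def by metis+
  have suc: "Suc 0 = 1" "Suc 1 = 2" "Suc 2 = 3" by simp_all
  ultimately show ?thesis
    using m unfolding less_3_cases C_SD_index[OF m j] dg_boundary_matrix_index[OF m j] e_def[symmetric]
    unfolding v' r_def[symmetric] s_def[symmetric] w_def[symmetric]
    using pos by (elim disjE; hypsubst; simp only: suc vertex_simps s_def[symmetric] fst_conv snd_conv)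
      (simp_all add: field_simps sq sq')
qed

end

section \<open>Assembly of the result\<close>

text \<open>\<open>mat_inverse\<close> returns an option: the value \<open>None\<close> is excluded
  because the identity is a unit of the matrix ring, and any returned inverse \<open>B\<close>
  equals \<open>1\<^sub>m n * B\<close>.\<close>

lemma mat_inverse_one: "the (mat_inverse (1\<^sub>m n :: 'a :: field mat)) = 1\<^sub>m n"
proof (cases "mat_inverse (1\<^sub>m n :: 'a mat)")
  case None
  then have "(1\<^sub>m n :: 'a mat) \<notin> Units (ring_mat TYPE('a) n undefined)"
    by (rule mat_inverse(1)[OF one_carrier_mat])
  then show ?thesis
    by (auto simp: Units_def ring_mat_def)
next
  case (Some B)
  then have "1\<^sub>m n * B = 1\<^sub>m n" "B \<in> carrier_mat n n"
    using mat_inverse(2)[OF one_carrier_mat Some] by auto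
  then show ?thesis
    using Some by simp
qed

theorem mainTheorem9:
  shows "{Q. extended_range 1 Q \<and> positive_definite (mass_matrix 1 + Q)} =
      {mat_of_rows_list 3 [[0, 0, 0], [0, q, 0], [0, 0, q]] | q. q > - 1} \<and>
    (\<forall>P. flux_points 1 P \<longrightarrow>
      mat_of_rows_list 3 [[0, 0, 0], [0, 1 / 3, 0], [0, 0, 1 / 3]] * C_SD 1 P {centroid} +
      mass_matrix 1 * (C_SD 1 P {centroid} - C_DG 1 P) = 0\<^sub>m 3 6)"
proof (intro conjI allI impI)
  \<comment> \<open>The sum is diagonal with entries 1, \<open>1 + q\<close>,
    \<open>1 + q\<close>.\<close>
  have "positive_definite (mass_matrix 1 + mat3 0 0 0 0 q 0 0 0 q) \<longleftrightarrow> q > - 1" for q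
    unfolding mass_matrix_1 mat3_one mat3_add using positive_definite_diag3_iff[of 1 "1 + q" "1 + q"]
    by auto
  then show "{Q. extended_range 1 Q \<and> positive_definite (mass_matrix 1 + Q)} =
      {mat3 0 0 0 0 q 0 0 0 q | q. q > - 1}"
    unfolding extended_range_1_iff by blast
next
  fix P
  assume "flux_points 1 P"
  then interpret flux_configuration P
    by unfold_locales
  let ?Q = "mat3 0 0 0 0 (1 / 3) 0 0 0 (1 / 3)"
  let ?S = "C_SD 1 P {centroid}"
  let ?B = "dg_boundary_matrix 1 P"
  have S: "?S \<in> carrier_mat 3 6"
    unfolding C_SD_def num_modes_1 by (intro carrier_matI) simp_all
  have B: "?B \<in> carrier_mat 3 6"
    unfolding dg_boundary_matrix_def num_modes_1 by (intro carrier_matI) simp_all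
  have DG: "C_DG 1 P = ?B"
    unfolding C_DG_def mass_matrix_1 mat_inverse_one using B by simp
  \<comment> \<open>As the mass matrix is the identity, \<open>C_DG\<close> is the boundary matrix
    \<open>?B\<close>. Row \<open>m\<close> of \<open>?Q * ?S\<close> is 0 or one third of row
    \<open>m\<close> of \<open>?S\<close>, so each entry reduces to
    \<open>C_SD_eq_dg_boundary_matrix\<close>.\<close>
  have entry: "(?Q * ?S + (?S - ?B)) $$ (m, j) = 0" if m: "m < 3" and j: "j < 6" for m j
  proof -
    have three: "{0..<3} = {0, 1, 2::nat}"
      by auto
    have "(?Q * ?S) $$ (m, j) = ?Q $$ (m, 0) * ?S $$ (0, j) + (?Q $$ (m, 1) * ?S $$ (1, j) + ?Q $$ (m, 2) * ?S $$ (2, j))"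
      using m j S mat3_carrier[of 0 0 0 0 "1 / 3" 0 0 0 "1 / 3"] by (simp add: scalar_prod_def three)
    also have "\<dots> = (if m = 0 then 0 else 1 / 3) * ?S $$ (m, j)"
      using m unfolding less_3_cases by (elim disjE; simp only: mat3_index) simp_all
    finally show ?thesis
      using C_SD_eq_dg_boundary_matrix[OF m j] m j S B mat3_carrier[of 0 0 0 0 "1 / 3" 0 0 0 "1 / 3"]
      by (simp split: if_splits)
  qed
  have "?Q * ?S + (?S - ?B) \<in> carrier_mat 3 6"
    using S B mat3_carrier by (intro add_carrier_mat minus_carrier_mat)
  then have "?Q * ?S + (?S - ?B) = 0\<^sub>m 3 6"
    using entry by (intro eq_matI) auto
  moreover have "1\<^sub>m 3 * (?S - ?B) = ?S - ?B"
    using S B by (intro left_mult_one_mat minus_carrier_mat)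
  ultimately show "?Q * ?S + mass_matrix 1 * (?S - C_DG 1 P) = 0\<^sub>m 3 6"
    unfolding mass_matrix_1 DG by simp
qed

end
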